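(* Let $(X,d)$ be a complete (proper geodesic) Busemann concave metric space that is (locally) doubling. Then for every $x\in X$ the tangent cone $(T_xX,d_x)$ is locally compact and is the unique limit, in the pointed Gromov-Hausdorff topology, of the blow-ups $(X,\frac1\lambda d,x)$ as $\lambda\to0$.
   Context: A metric space is proper if closed bounded subsets are compact. A geodesic from $x$ to $y$ is a map $\gamma:[0,1]\to X$ with $\gamma(0)=x$, $\gamma(1)=y$ and $d(\gamma(t),\gamma(s))=|t-s|\,d(x,y)$; $X$ is geodesic if any two points are joined by a geodesic. A geodesic space $(X,d)$ is Busemann concave if for all $x,y_1,y_2\in X$ and all geodesics $\gamma_i$ from $x$ to $y_i$ ($i=1,2$) the function $t\mapsto d(\gamma_1(t),\gamma_2(t))$ is concave on $[0,1]$. Locally doubling: for every $x\in X$ there are $R>0$ and $N\in\mathbb{N}$ such that every ball of radius $r\le R$ with center in $B_R(x)$ can be covered by $N$ balls of radius $r/2$. Tangent cone: let $\Gamma_x$ be the set of maximal (not further extendable) unit speed geodesics starting at $x$, and let $\hat T_xX$ be $\Gamma_x\times[0,\infty)$ with all points $(\gamma,0)$ identified. For $\gamma,\eta\in\Gamma_x$ choose $a>0$ such that both are defined on $[0,a]$ and set $$d_x((\gamma,s),(\eta,t))=\sup_{r\in(0,1],\ \max\{rs,rt\}\le a}\frac{d(\gamma(rs),\eta(rt))}{r}.$$ For Busemann concave $X$ this is a well-defined metric on $\hat T_xX$, and the tangent cone $(T_xX,d_x)$ is the metric completion of $(\hat T_xX,d_x)$. Pointed Gromov-Hausdorff convergence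 of $(X_n,d_n,x_n)$ to $(Y,d_Y,y)$: for every $r>0$ the balls $B_r(x_n)\subset X_n$ converge to $B_r(y)\subset Y$ in the Gromov-Hausdorff distance, where the distance is computed with isometric embeddings into common metric spaces mapping the base points to the same point. The base point of $T_xX$ is the apex, the class of the points $(\gamma,0)$.
   Formalization: Uniqueness of the limit is claimed among complete pointed metric spaces, up to base-point preserving isometry; without completeness it fails (for X = ℝ, both ℝ and ℚ are limits of the blow-ups). *)

theory Defs
  imports "HOL-Analysis.Analysis"
begin

section \<open>Classes of metric spaces\<close>

definition proper_metric :: "'a metric \<Rightarrow> bool" where
  "proper_metric X \<longleftrightarrow>
     (\<forall>S. closedin (mtopology_of X) S \<and> Metric_space.mbounded (mspace X) (mdist X) S
        \<longrightarrow> compactin (mtopology_of X) S)"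

definition geodesic_from_to :: "'a metric \<Rightarrow> (real \<Rightarrow> 'a) \<Rightarrow> 'a \<Rightarrow> 'a \<Rightarrow> bool" where
  "geodesic_from_to X \<gamma> x y \<longleftrightarrow>
     \<gamma> \<in> {0..1} \<rightarrow> mspace X \<and> \<gamma> 0 = x \<and> \<gamma> 1 = y \<and>
     (\<forall>s\<in>{0..1}. \<forall>t\<in>{0..1}. mdist X (\<gamma> t) (\<gamma> s) = \<bar>t - s\<bar> * mdist X x y)"

definition geodesic_metric :: "'a metric \<Rightarrow> bool" where
  "geodesic_metric X \<longleftrightarrow> (\<forall>x\<in>mspace X. \<forall>y\<in>mspace X. \<exists>\<gamma>. geodesic_from_to X \<gamma> x y)"

definition busemann_concave :: "'a metric \<Rightarrow> bool" where
  "busemann_concave X \<longleftrightarrow> geodesic_metric X \<and>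
     (\<forall>x\<in>mspace X. \<forall>y1\<in>mspace X. \<forall>y2\<in>mspace X. \<forall>\<gamma>1 \<gamma>2.
        geodesic_from_to X \<gamma>1 x y1 \<and> geodesic_from_to X \<gamma>2 x y2
        \<longrightarrow> concave_on {0..1} (\<lambda>t. mdist X (\<gamma>1 t) (\<gamma>2 t)))"

definition locally_doubling :: "'a metric \<Rightarrow> bool" where
  "locally_doubling X \<longleftrightarrow>
     (\<forall>x\<in>mspace X. \<exists>R>0. \<exists>N::nat. \<forall>y\<in>mball_of X x R. \<forall>r. 0 < r \<and> r \<le> R \<longrightarrow>
        (\<exists>C. C \<subseteq> mspace X \<and> finite C \<and> card C \<le> N \<and>
             mball_of X y r \<subseteq> (\<Union>c\<in>C. mball_of X c (r / 2))))"

section \<open>Isometric embeddings and metric completion\<close>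

definition isometric_embedding :: "'a metric \<Rightarrow> 'b metric \<Rightarrow> ('a \<Rightarrow> 'b) \<Rightarrow> bool" where
  "isometric_embedding X Y f \<longleftrightarrow>
     f \<in> mspace X \<rightarrow> mspace Y \<and>
     (\<forall>x\<in>mspace X. \<forall>y\<in>mspace X. mdist Y (f x) (f y) = mdist X x y)"

definition pointed_isometric :: "'a metric \<Rightarrow> 'a \<Rightarrow> 'b metric \<Rightarrow> 'b \<Rightarrow> bool" where
  "pointed_isometric X x Y y \<longleftrightarrow>
     (\<exists>f. isometric_embedding X Y f \<and> f ` mspace X = mspace Y \<and> f x = y)"

definition is_metric_completion :: "'a metric \<Rightarrow> 'b metric \<Rightarrow> ('a \<Rightarrow> 'b) \<Rightarrow> bool" where
  "is_metric_completion X T \<iota> \<longleftrightarrow>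
     mcomplete_of T \<and> isometric_embedding X T \<iota> \<and>
     mtopology_of T closure_of (\<iota> ` mspace X) = mspace T"

text \<open>
  The completion is determined only up to isometry; a representative (with the embedding of the
  original space) is chosen in the type \<open>'a \<Rightarrow> real\<close>, where one always exists.
\<close>

definition metric_completion_of :: "'a metric \<Rightarrow> ('a \<Rightarrow> real) metric \<times> ('a \<Rightarrow> 'a \<Rightarrow> real)" where
  "metric_completion_of X = (SOME (T, \<iota>). is_metric_completion X T \<iota>)"

lemma is_metric_completion_metric_completion_of:
  "is_metric_completion X (fst (metric_completion_of X)) (snd (metric_completion_of X))"
proof -
  interpret Metric_space "mspace X" "mdist X" by simp
  obtain f :: "'a \<Rightarrow> 'a \<Rightarrow> real" and m' where
    "mcomplete_of m'" "f \<in> mspace X \<rightarrow> mspace m'"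
    "mtopology_of m' closure_of f ` mspace X = mspace m'"
    "\<And>x y. \<lbrakk>x \<in> mspace X; y \<in> mspace X\<rbrakk> \<Longrightarrow> mdist m' (f x) (f y) = mdist X x y"
    using metric_completion by metis
  then have "case (m', f) of (T, \<iota>) \<Rightarrow> is_metric_completion X T \<iota>"
    by (simp add: is_metric_completion_def isometric_embedding_def)
  then have "case metric_completion_of X of (T, \<iota>) \<Rightarrow> is_metric_completion X T \<iota>"
    unfolding metric_completion_of_def by (rule someI)
  then show ?thesis by (simp add: case_prod_beta)
qed

section \<open>The tangent cone\<close>

text \<open>
  A unit speed geodesic is a pair of its domain, an interval \<open>I \<subseteq> [0,\<infinity>)\<close> containing \<open>0\<close>, and an
  isometric map on it.  The map takes the value \<open>undefined\<close> outside \<open>I\<close> (extensionality), so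
  that equality of pairs is equality of geodesics.  Constant geodesics on \<open>{0}\<close> are excluded;
  in a geodesic space this matters only for the one-point space, where no \<open>a > 0\<close> as in the
  definition of the cone metric would exist.
\<close>

type_synonym 'a path = "real set \<times> (real \<Rightarrow> 'a)"

definition unit_speed_geodesic :: "'a metric \<Rightarrow> 'a \<Rightarrow> 'a path \<Rightarrow> bool" where
  "unit_speed_geodesic X x = (\<lambda>(I, \<gamma>).
     is_interval I \<and> 0 \<in> I \<and> I \<subseteq> {0..} \<and> I \<noteq> {0} \<and>
     \<gamma> \<in> I \<rightarrow>\<^sub>E mspace X \<and> \<gamma> 0 = x \<and>
     (\<forall>s\<in>I. \<forall>t\<in>I. mdist X (\<gamma> s) (\<gamma> t) = \<bar>s - t\<bar>))"

definition maximal_geodesics :: "'a metric \<Rightarrow> 'a \<Rightarrow> 'a path set" where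
  "maximal_geodesics X x = {(I, \<gamma>). unit_speed_geodesic X x (I, \<gamma>) \<and>
     (\<forall>J \<eta>. unit_speed_geodesic X x (J, \<eta>) \<and> I \<subseteq> J \<and> (\<forall>t\<in>I. \<eta> t = \<gamma> t) \<longrightarrow> J = I)}"

text \<open>
  Points of \<open>\<Gamma>\<^sub>x \<times> [0,\<infinity>)\<close> with all \<open>(\<gamma>, 0)\<close> identified: \<open>Apex\<close> is the class of the points
  \<open>(\<gamma>, 0)\<close>, and \<open>Ray \<gamma> s\<close> with \<open>s > 0\<close> is the point \<open>(\<gamma>, s)\<close>.  The apex is present even if
  \<open>\<Gamma>\<^sub>x\<close> is empty, so that the cone over the one-point space is a point.
\<close>

datatype 'a cone_point = Apex | Ray "'a path" real

definition precone_points :: "'a metric \<Rightarrow> 'a \<Rightarrow> 'a cone_point set" where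
  "precone_points X x = insert Apex {Ray \<gamma> s | \<gamma> s. \<gamma> \<in> maximal_geodesics X x \<and> 0 < s}"

text \<open>
  A representative \<open>(\<gamma>, s)\<close> of a cone point.  For the apex \<open>s = 0\<close>, so that only \<open>\<gamma> 0 = x\<close>
  enters the cone metric, and the constant map on \<open>[0,\<infinity>)\<close> may stand for any geodesic.
\<close>

fun cone_path :: "'a \<Rightarrow> 'a cone_point \<Rightarrow> 'a path" where
  "cone_path x Apex = ({0..}, \<lambda>_. x)"
| "cone_path x (Ray \<gamma> s) = \<gamma>"

fun cone_radius :: "'a cone_point \<Rightarrow> real" where
  "cone_radius Apex = 0"
| "cone_radius (Ray \<gamma> s) = s"

text \<open>
  The value \<open>0\<close> off the carrier is needed because the locale \<open>Metric_space\<close> requires nonnegativity everywhere.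
\<close>

definition precone_dist :: "'a metric \<Rightarrow> 'a \<Rightarrow> 'a cone_point \<Rightarrow> 'a cone_point \<Rightarrow> real" where
  "precone_dist X x p q =
    (if p \<in> precone_points X x \<and> q \<in> precone_points X x then
       let (I, \<gamma>) = cone_path x p; s = cone_radius p;
           (J, \<eta>) = cone_path x q; t = cone_radius q;
           a = (SOME a. 0 < a \<and> {0..a} \<subseteq> I \<inter> J)
       in SUP r\<in>{r. 0 < r \<and> r \<le> 1 \<and> max (r * s) (r * t) \<le> a}. mdist X (\<gamma> (r * s)) (\<eta> (r * t)) / r
     else 0)"

definition precone :: "'a metric \<Rightarrow> 'a \<Rightarrow> 'a cone_point metric" where
  "precone X x = metric (precone_points X x, precone_dist X x)"

definition tangent_cone :: "'a metric \<Rightarrow> 'a \<Rightarrow> ('a cone_point \<Rightarrow> real) metric" where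
  "tangent_cone X x = fst (metric_completion_of (precone X x))"

definition tangent_apex :: "'a metric \<Rightarrow> 'a \<Rightarrow> 'a cone_point \<Rightarrow> real" where
  "tangent_apex X x = snd (metric_completion_of (precone X x)) Apex"

section \<open>Pointed Gromov-Hausdorff convergence\<close>

definition hausdorff_distance :: "'a metric \<Rightarrow> 'a set \<Rightarrow> 'a set \<Rightarrow> ennreal" where
  "hausdorff_distance Z A B = Inf {ennreal e | e. 0 < e \<and>
     (\<forall>a\<in>A. \<exists>b\<in>B. mdist Z a b < e) \<and> (\<forall>b\<in>B. \<exists>a\<in>A. mdist Z a b < e)}"

text \<open>
  The common space \<open>Z\<close> ranges over metric spaces on subsets of the sum type.  This is no
  restriction: \<open>Z\<close> may be replaced by the union of the two images, whose points can be named by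
  preimages in the disjoint sum.
\<close>

definition pointed_GH_dist :: "'a metric \<Rightarrow> 'a \<Rightarrow> 'b metric \<Rightarrow> 'b \<Rightarrow> ennreal" where
  "pointed_GH_dist A a B b =
     Inf {hausdorff_distance Z (f ` mspace A) (g ` mspace B) | (Z :: ('a + 'b) metric) f g.
            isometric_embedding A Z f \<and> isometric_embedding B Z g \<and> f a = g b}"

definition pointed_ball :: "'a metric \<Rightarrow> 'a \<Rightarrow> real \<Rightarrow> 'a metric" where
  "pointed_ball X x r = submetric X (mball_of X x r)"

definition pointed_GH_limit ::
    "('i \<Rightarrow> 'a metric) \<Rightarrow> ('i \<Rightarrow> 'a) \<Rightarrow> 'b metric \<Rightarrow> 'b \<Rightarrow> 'i filter \<Rightarrow> bool" where
  "pointed_GH_limit X x Y y F \<longleftrightarrow> y \<in> mspace Y \<and>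
     (\<forall>r>0. ((\<lambda>i. pointed_GH_dist (pointed_ball (X i) (x i) r) (x i) (pointed_ball Y y r) y) \<longlongrightarrow> 0) F)"

text \<open>A metric space only for \<open>0 < l\<close>.\<close>

definition blow_up :: "'a metric \<Rightarrow> real \<Rightarrow> 'a metric" where
  "blow_up X l = metric (mspace X, \<lambda>a b. (1 / l) * mdist X a b)"

end

theory Submission
  imports Defs
begin

text \<open>
  For \<open>p = (\<gamma>, s)\<close> in the cone put \<open>exp p r = \<gamma> (r s)\<close>.  By concavity \<open>d (exp p r) (exp q r) / r\<close>
  decreases in \<open>r\<close>, so the cone distance is its limit as \<open>r \<rightarrow> 0\<close> and bounds it from above: at
  scale \<open>r\<close> the exponential map is 1-Lipschitz where defined, almost isometric on finite sets for
  small \<open>r\<close>, and onto \<open>X\<close>, because geodesics extend to maximal ones.  Doubling bounds the size of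
  separated sets in small balls of \<open>X\<close>, hence in balls of the cone, which are therefore totally
  bounded.  A finite net in a ball of the cone is then carried to a net in the ball of the blow-up
  with almost the same distances, and gluing along these nets gives convergence.

  For uniqueness, any two limits admit almost isometric maps between finite subsets.  Compactness of
  closed balls (Tychonoff) turns these into isometric embeddings in both directions, and an
  isometric self-map of a compact space is onto.
\<close>

section \<open>Uniqueness of pointed Gromov-Hausdorff limits\<close>

lemma mdist_refl: "u \<in> mspace X \<Longrightarrow> mdist X u u = 0"
  by simp

lemma isometric_embeddingD:
  assumes "isometric_embedding X Y f"
  shows "\<And>u. u \<in> mspace X \<Longrightarrow> f u \<in> mspace Y"
    and "\<And>u v. u \<in> mspace X \<Longrightarrow> v \<in> mspace X \<Longrightarrow> mdist Y (f u) (f v) = mdist X u v"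
  using assms by (auto simp: isometric_embedding_def)

lemma hausdorff_distance_lessD:
  assumes "hausdorff_distance Z A B < ennreal e"
  shows "\<forall>a\<in>A. \<exists>b\<in>B. mdist Z a b < e" and "\<forall>b\<in>B. \<exists>a\<in>A. mdist Z a b < e"
proof -
  obtain e' where e': "ennreal e' < ennreal e" "0 < e'"
    "\<forall>a\<in>A. \<exists>b\<in>B. mdist Z a b < e'" "\<forall>b\<in>B. \<exists>a\<in>A. mdist Z a b < e'"
    using assms unfolding hausdorff_distance_def Inf_less_iff by auto
  have "e' < e"
    using e'(1,2) by (simp add: ennreal_less_iff)
  then show "\<forall>a\<in>A. \<exists>b\<in>B. mdist Z a b < e" "\<forall>b\<in>B. \<exists>a\<in>A. mdist Z a b < e"
    using e'(3,4) by (meson less_trans)+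
qed

text \<open>Moving two points of \<open>Z\<close> by less than \<open>e\<close> each changes their
  distance by less than \<open>2 * e\<close>, so any choice of nearby points is almost
  isometric.\<close>

lemma pointed_approximation:
  assumes f: "isometric_embedding A Z f" and g: "isometric_embedding B Z g" and eq: "f a = g b"
    and a: "a \<in> mspace A" and b: "b \<in> mspace B" and "0 < e"
    and near: "\<And>u. u \<in> mspace A \<Longrightarrow> \<exists>v\<in>mspace B. mdist Z (f u) (g v) < e"
  shows "\<exists>h. h \<in> mspace A \<rightarrow> mspace B \<and> h a = b \<and>
           (\<forall>u\<in>mspace A. \<forall>v\<in>mspace A. \<bar>mdist B (h u) (h v) - mdist A u v\<bar> < 2 * e)"
proof -
  note fD = isometric_embeddingD[OF f] and gD = isometric_embeddingD[OF g]
  have "mdist Z (f a) (g b) < e"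
    using \<open>0 < e\<close> eq gD(1)[OF b] by (simp add: mdist_refl)
  \<comment> \<open>At \<open>a\<close> the choice is forced to be \<open>b\<close>, which qualifies
    because the base points have the same image in \<open>Z\<close>.\<close>
  then have "\<exists>v\<in>mspace B. mdist Z (f u) (g v) < e \<and> (u = a \<longrightarrow> v = b)" if "u \<in> mspace A" for u
    using near[OF that] b by (cases "u = a") auto
  then obtain h where h: "\<And>u. u \<in> mspace A \<Longrightarrow> h u \<in> mspace B"
    "\<And>u. u \<in> mspace A \<Longrightarrow> mdist Z (f u) (g (h u)) < e" and "h a = b"
    using a by metis
  have "\<bar>mdist B (h u) (h v) - mdist A u v\<bar> < 2 * e" if "u \<in> mspace A" "v \<in> mspace A" for u v
  proof -
    have in_Z: "f u \<in> mspace Z" "f v \<in> mspace Z" "g (h u) \<in> mspace Z" "g (h v) \<in> mspace Z"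
      using that fD(1) gD(1) h(1) by auto
    have "mdist Z (g (h u)) (g (h v)) \<le> mdist Z (g (h u)) (f u) + mdist Z (f u) (f v) + mdist Z (f v) (g (h v))"
      "mdist Z (f u) (f v) \<le> mdist Z (f u) (g (h u)) + mdist Z (g (h u)) (g (h v)) + mdist Z (g (h v)) (f v)"
      using in_Z by (smt (verit) mdist_triangle)+
    then show ?thesis
      using h(2)[OF that(1)] h(2)[OF that(2)] that h(1) fD(2) gD(2)
      by (simp add: mdist_commute abs_less_iff)
  qed
  then show ?thesis
    using h(1) \<open>h a = b\<close> by blast
qed

lemma pointed_GH_dist_lessD:
  assumes less: "pointed_GH_dist A a B b < ennreal e" and a: "a \<in> mspace A" and b: "b \<in> mspace B"
  shows "\<exists>h. h \<in> mspace A \<rightarrow> mspace B \<and> h a = b \<and>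
           (\<forall>u\<in>mspace A. \<forall>v\<in>mspace A. \<bar>mdist B (h u) (h v) - mdist A u v\<bar> < 2 * e)" (is ?AB)
    and "\<exists>h. h \<in> mspace B \<rightarrow> mspace A \<and> h b = a \<and>
           (\<forall>u\<in>mspace B. \<forall>v\<in>mspace B. \<bar>mdist A (h u) (h v) - mdist B u v\<bar> < 2 * e)" (is ?BA)
proof -
  obtain Z :: "('a + 'b) metric" and f g where Z: "isometric_embedding A Z f" "isometric_embedding B Z g" "f a = g b"
    "hausdorff_distance Z (f ` mspace A) (g ` mspace B) < ennreal e"
    using less unfolding pointed_GH_dist_def Inf_less_iff by auto
  have "0 < e"
    using less by (metis ennreal_neg not_less not_less_zero)
  note near = hausdorff_distance_lessD[OF Z(4)]
  show ?AB
    using near(1) by (intro pointed_approximation[OF Z(1-3) a b \<open>0 < e\<close>]) auto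
  show ?BA
    using near(2) by (intro pointed_approximation[OF Z(2,1) Z(3)[symmetric] b a \<open>0 < e\<close>]) (auto simp: mdist_commute)
qed

text \<open>The two limits are compared through a single \<open>X i\<close>: first map
  \<open>S\<close> into a ball of \<open>X i\<close>, then map that ball into
  \<open>T\<close>.\<close>

lemma common_limit_approximation:
  assumes Y: "pointed_GH_limit X x Y y F" and T: "pointed_GH_limit X x T t F"
    and x: "\<forall>\<^sub>F i in F. x i \<in> mspace (X i)" and "F \<noteq> bot"
    and S: "finite S" "S \<subseteq> mspace Y" "y \<in> S" and "0 < e"
  shows "\<exists>h. h ` S \<subseteq> mspace T \<and> h y = t \<and> (\<forall>u\<in>S. \<forall>v\<in>S. \<bar>mdist T (h u) (h v) - mdist Y u v\<bar> \<le> e)"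
proof -
  \<comment> \<open>The added 1 keeps \<open>S\<close> inside the open ball.\<close>
  define r where "r = Max (mdist Y y ` S) + 1"
  have r: "mdist Y y u < r" if "u \<in> S" for u
  proof -
    have "mdist Y y u \<le> Max (mdist Y y ` S)"
      using S(1) that by (intro Max_ge) auto
    then show ?thesis
      by (simp add: r_def)
  qed
  have "0 < r"
    using r[OF S(3)] mdist_nonneg[of Y y y] by linarith
  have y: "y \<in> mspace Y" and t: "t \<in> mspace T"
    using Y T by (auto simp: pointed_GH_limit_def)
  \<comment> \<open>A distance below \<open>e / 4\<close> gives maps of distortion below
    \<open>e / 2\<close>, and two of them are composed.\<close>
  have "ennreal (e / 4) > 0"
    using \<open>0 < e\<close> by simp
  then have "\<forall>\<^sub>F i in F. pointed_GH_dist (pointed_ball (X i) (x i) r) (x i) (pointed_ball Y y r) y < ennreal (e / 4)"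
    "\<forall>\<^sub>F i in F. pointed_GH_dist (pointed_ball (X i) (x i) r) (x i) (pointed_ball T t r) t < ennreal (e / 4)"
    using Y T \<open>0 < r\<close> by (auto simp: pointed_GH_limit_def intro!: order_tendstoD(2))
  with x have "\<forall>\<^sub>F i in F. x i \<in> mspace (X i) \<and>
      pointed_GH_dist (pointed_ball (X i) (x i) r) (x i) (pointed_ball Y y r) y < ennreal (e / 4) \<and>
      pointed_GH_dist (pointed_ball (X i) (x i) r) (x i) (pointed_ball T t r) t < ennreal (e / 4)"
    by eventually_elim auto
  then obtain i where xi: "x i \<in> mspace (X i)"
    and iY: "pointed_GH_dist (pointed_ball (X i) (x i) r) (x i) (pointed_ball Y y r) y < ennreal (e / 4)"
    and iT: "pointed_GH_dist (pointed_ball (X i) (x i) r) (x i) (pointed_ball T t r) t < ennreal (e / 4)"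
    using \<open>F \<noteq> bot\<close> eventually_happens' by blast
  let ?B = "pointed_ball (X i) (x i) r"
  have base: "x i \<in> mspace ?B" "y \<in> mspace (pointed_ball Y y r)" "t \<in> mspace (pointed_ball T t r)"
    using xi y t \<open>0 < r\<close> by (auto simp: pointed_ball_def mdist_refl)
  obtain k where k: "k \<in> mspace (pointed_ball Y y r) \<rightarrow> mspace ?B" "k y = x i"
    "\<forall>u\<in>mspace (pointed_ball Y y r). \<forall>v\<in>mspace (pointed_ball Y y r).
       \<bar>mdist ?B (k u) (k v) - mdist (pointed_ball Y y r) u v\<bar> < 2 * (e / 4)"
    using pointed_GH_dist_lessD(2)[OF iY base(1,2)] by auto
  obtain h where h: "h \<in> mspace ?B \<rightarrow> mspace (pointed_ball T t r)" "h (x i) = t"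
    "\<forall>u\<in>mspace ?B. \<forall>v\<in>mspace ?B. \<bar>mdist (pointed_ball T t r) (h u) (h v) - mdist ?B u v\<bar> < 2 * (e / 4)"
    using pointed_GH_dist_lessD(1)[OF iT base(1,3)] by auto
  have SB: "u \<in> mspace (pointed_ball Y y r)" if "u \<in> S" for u
    using that S r y by (auto simp: pointed_ball_def)
  have "h (k u) \<in> mspace T" if "u \<in> S" for u
    using h(1) k(1) SB[OF that] by (fastforce simp: pointed_ball_def)
  moreover have "\<bar>mdist T (h (k u)) (h (k v)) - mdist Y u v\<bar> \<le> e" if "u \<in> S" "v \<in> S" for u v
  proof -
    have "k u \<in> mspace ?B" "k v \<in> mspace ?B"
      using k(1) SB that by auto
    then have "\<bar>mdist T (h (k u)) (h (k v)) - mdist ?B (k u) (k v)\<bar> < 2 * (e / 4)"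
      using h(3) by (simp add: pointed_ball_def)
    moreover have "\<bar>mdist ?B (k u) (k v) - mdist Y u v\<bar> < 2 * (e / 4)"
      using k(3) SB that by (simp add: pointed_ball_def)
    ultimately show ?thesis by linarith
  qed
  ultimately show ?thesis
    using h(2) k(2) by (intro exI[of _ "h \<circ> k"]) auto
qed

section \<open>Isometric embeddings and surjectivity from compactness\<close>

text \<open>By Tychonoff the maps that send each \<open>u\<close> into a prescribed closed ball
  around \<open>t\<close> form a compact space \<open>P\<close>. Each set \<open>C (u, v, e)\<close>
  is closed in it, and one approximation on a finite set lies in any finitely many of them. A common
  point of all is isometric.\<close>

lemma isometric_embedding_from_approximations:
  assumes y: "y \<in> mspace Y" and t: "t \<in> mspace T"
    and cpt: "\<And>R. compactin (mtopology_of T) (mcball_of T t R)"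
    and approx: "\<And>S e. finite S \<Longrightarrow> S \<subseteq> mspace Y \<Longrightarrow> y \<in> S \<Longrightarrow> (0::real) < e \<Longrightarrow>
      \<exists>h. h ` S \<subseteq> mspace T \<and> h y = t \<and> (\<forall>u\<in>S. \<forall>v\<in>S. \<bar>mdist T (h u) (h v) - mdist Y u v\<bar> \<le> e)"
  shows "\<exists>f. isometric_embedding Y T f \<and> f y = t"
proof -
  \<comment> \<open>An approximation with error at most 1 sends \<open>u\<close> into the ball of
    radius \<open>mdist Y y u + 1\<close>; radius 0 at \<open>y\<close> forces
    \<open>f y = t\<close>.\<close>
  define R where "R u = (if u = y then 0 else mdist Y y u + 1)" for u
  define P where "P = product_topology (\<lambda>u. subtopology (mtopology_of T) (mcball_of T t (R u))) (mspace Y)"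
  define I where "I = mspace Y \<times> mspace Y \<times> {0::real<..}"
  define C where "C = (\<lambda>(u, v, e). {h \<in> topspace P. \<bar>mdist T (h u) (h v) - mdist Y u v\<bar> \<in> {..e}})"
  have topP: "topspace P = (\<Pi>\<^sub>E u\<in>mspace Y. mcball_of T t (R u))"
    unfolding P_def by (auto simp: PiE_iff)
  have "compact_space P"
    unfolding P_def compact_space_product_topology using cpt by (auto intro: compact_space_subtopology)
  moreover have "closedin P D" if "D \<in> C ` I" for D
  proof -
    obtain u v e where D: "D = C (u, v, e)" and uv: "u \<in> mspace Y" "v \<in> mspace Y"
      using \<open>D \<in> C ` I\<close> by (auto simp: I_def)
    have "continuous_map P (mtopology_of T) (\<lambda>h. h w)" if "w \<in> mspace Y" for w
      using continuous_map_product_projection[OF that] unfolding P_def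
      by (blast intro: continuous_map_into_fulltopology)
    then have "continuous_map P euclideanreal (\<lambda>h. \<bar>mdist T (h u) (h v) - mdist Y u v\<bar>)"
      using uv by (intro continuous_intros) auto
    then show ?thesis
      unfolding D C_def prod.case by (rule closedin_continuous_map_preimage) simp
  qed
  moreover have "\<Inter> \<F> \<noteq> {}" if "finite \<F>" "\<F> \<subseteq> C ` I" for \<F>
  proof -
    from finite_subset_image[OF that]
    obtain J where J: "J \<subseteq> I" "finite J" "\<F> = C ` J"
      by metis
    define S where "S = insert y (fst ` J \<union> (fst \<circ> snd) ` J)"
    \<comment> \<open>Inserting 1 keeps the error within the slack that \<open>R\<close> allows and
      covers empty \<open>J\<close>.\<close>
    define e where "e = Min (insert 1 ((snd \<circ> snd) ` J))"
    have eJ: "e \<le> snd (snd j)" if "j \<in> J" for j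
      unfolding e_def using J(2) that by (intro Min_le) auto
    have "0 < e" "e \<le> 1"
      using J(1,2) by (auto simp: e_def I_def)
    have S: "finite S" "S \<subseteq> mspace Y" "y \<in> S"
      using J(1,2) y by (auto simp: S_def I_def)
    obtain h where h: "h ` S \<subseteq> mspace T" "h y = t" "\<forall>u\<in>S. \<forall>v\<in>S. \<bar>mdist T (h u) (h v) - mdist Y u v\<bar> \<le> e"
      using approx[OF S \<open>0 < e\<close>] by auto
    \<comment> \<open>Points off \<open>S\<close> are not constrained by \<open>J\<close>; the value
      \<open>t\<close> lies in every prescribed ball.\<close>
    define h' where "h' = (\<lambda>u\<in>mspace Y. if u \<in> S then h u else t)"
    have "h' \<in> topspace P"
      unfolding topP
    proof
      fix u assume u: "u \<in> mspace Y"
      have "mdist T t (h u) \<le> R u" "h u \<in> mspace T" if "u \<in> S"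
      proof -
        have "\<bar>mdist T (h y) (h u) - mdist Y y u\<bar> \<le> e"
          using h(3) that S by auto
        then show "mdist T t (h u) \<le> R u"
          using h(2) \<open>e \<le> 1\<close> t by (auto simp: R_def mdist_refl)
        show "h u \<in> mspace T"
          using h(1) that by auto
      qed
      then show "h' u \<in> mcball_of T t (R u)"
        using u t S(3) by (auto simp: h'_def R_def mdist_refl)
    qed (auto simp: h'_def)
    moreover have "\<bar>mdist T (h' u) (h' v) - mdist Y u v\<bar> \<le> e'" if "(u, v, e') \<in> J" for u v e'
    proof -
      have "u \<in> S" "v \<in> S"
        using that by (force simp: S_def)+
      moreover have "u \<in> mspace Y" "v \<in> mspace Y"
        using that J(1) by (auto simp: I_def)
      moreover have "\<bar>mdist T (h u) (h v) - mdist Y u v\<bar> \<le> e"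
        using h(3) calculation by blast
      ultimately show ?thesis
        using eJ[OF that] by (simp add: h'_def)
    qed
    ultimately have "h' \<in> \<Inter> \<F>"
      unfolding J C_def by auto
    then show ?thesis by blast
  qed
  ultimately have "\<Inter> (C ` I) \<noteq> {}"
    unfolding compact_space_fip by (elim allE[of _ "C ` I"]) simp
  then obtain f where f: "\<And>i. i \<in> I \<Longrightarrow> f \<in> C i"
    by blast
  \<comment> \<open>One index is needed to know that \<open>f\<close> lies in
    \<open>topspace P\<close> at all.\<close>
  have "(y, y, 1) \<in> I"
    using y by (simp add: I_def)
  then have "f \<in> topspace P"
    using f unfolding C_def by force
  then have fT: "f u \<in> mcball_of T t (R u)" if "u \<in> mspace Y" for u
    using that unfolding topP by auto
  have "mdist T (f u) (f v) = mdist Y u v" if "u \<in> mspace Y" "v \<in> mspace Y" for u v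
  proof -
    have "\<bar>mdist T (f u) (f v) - mdist Y u v\<bar> \<le> 0 + e" if "0 < e" for e
      using f[of "(u, v, e)"] that \<open>u \<in> mspace Y\<close> \<open>v \<in> mspace Y\<close> by (simp add: C_def I_def)
    then have "\<bar>mdist T (f u) (f v) - mdist Y u v\<bar> \<le> 0"
      by (rule field_le_epsilon)
    then show ?thesis by simp
  qed
  moreover have "f y = t"
  proof -
    have "mdist T t (f y) \<le> 0" "f y \<in> mspace T"
      using fT[OF y] by (auto simp: R_def)
    then show ?thesis
      using t mdist_nonneg[of T t "f y"] mdist_zero[of t T "f y"] by auto
  qed
  ultimately show ?thesis
    using fT by (auto simp: isometric_embedding_def)
qed

lemma isometric_embedding_imp_continuous_map:
  assumes "isometric_embedding X Y f"
  shows "continuous_map (mtopology_of X) (mtopology_of Y) f"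
proof -
  have "Lipschitz_continuous_map X Y f"
    using assms unfolding Lipschitz_continuous_map_def isometric_embedding_def
    by (intro conjI exI[of _ 1]) auto
  then show ?thesis
    by (rule Lipschitz_continuous_imp_continuous_map)
qed

text \<open>The iterates of a point outside the image of \<open>f\<close> would be uniformly separated.\<close>
lemma isometric_self_map_compact_surj:
  assumes K: "compactin (mtopology_of T) K" and f: "f \<in> K \<rightarrow> K"
    and iso: "\<And>u v. u \<in> K \<Longrightarrow> v \<in> K \<Longrightarrow> mdist T (f u) (f v) = mdist T u v"
  shows "f ` K = K"
proof (rule ccontr)
  assume "f ` K \<noteq> K"
  then obtain t where t: "t \<in> K" "t \<notin> f ` K"
    using f by blast
  interpret T: Metric_space "mspace T" "mdist T" by simp
  have KT: "K \<subseteq> mspace T"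
    using compactin_subset_topspace[OF K] by simp
  have "isometric_embedding (submetric T K) T f"
    using f iso KT by (auto simp: isometric_embedding_def)
  then have "continuous_map (subtopology (mtopology_of T) K) (mtopology_of T) f"
    using isometric_embedding_imp_continuous_map by (metis mtopology_of_submetric)
  then have "compactin (mtopology_of T) (f ` K)"
    using K by (intro image_compactin[where X = "subtopology (mtopology_of T) K"]) (auto simp: compactin_subtopology)
  then have "closedin T.mtopology (f ` K)"
    unfolding mtopology_of_def by (intro compactin_imp_closedin T.Hausdorff_space_mtopology)
  \<comment> \<open>The image is compact, hence closed, so a whole ball around \<open>t\<close>
    misses it.\<close>
  then have "openin T.mtopology (mspace T - f ` K)"
    by (metis T.topspace_mtopology openin_diff openin_topspace)
  moreover have "t \<in> mspace T - f ` K"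
    using t KT by auto
  ultimately obtain \<delta> where "0 < \<delta>" and \<delta>: "T.mball t \<delta> \<subseteq> mspace T - f ` K"
    unfolding T.openin_mtopology by blast
  define \<sigma> where "\<sigma> n = (f ^^ n) t" for n
  have \<sigma>K: "\<sigma> n \<in> K" for n
    by (induction n) (use f t in \<open>auto simp: \<sigma>_def\<close>)
  \<comment> \<open>Cancelling \<open>n\<close> applications of the isometric map reduces every gap
    to one that starts at \<open>t\<close>.\<close>
  have shift: "mdist T (\<sigma> (n + m)) (\<sigma> n) = mdist T (\<sigma> m) t" for m n
  proof (induction n)
    case (Suc n)
    then show ?case
      using iso[OF \<sigma>K[of "n + m"] \<sigma>K[of n]] by (simp add: \<sigma>_def)
  qed (simp add: \<sigma>_def)
  have far: "\<delta> \<le> mdist T (\<sigma> (n + Suc m)) (\<sigma> n)" for m n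
  proof -
    have "\<sigma> (Suc m) \<in> f ` K"
      using \<sigma>K[of m] by (simp add: \<sigma>_def)
    then have "\<sigma> (Suc m) \<notin> T.mball t \<delta>"
      using \<delta> by blast
    then show ?thesis
      using t \<sigma>K[of "Suc m"] KT shift[of n "Suc m"] by (auto simp: mdist_commute)
  qed
  \<comment> \<open>Compactness gives the orbit a Cauchy subsequence, which contradicts the
    separation by \<delta>.\<close>
  have "range \<sigma> \<subseteq> K"
    using \<sigma>K by auto
  then obtain r where r: "strict_mono r" "T.MCauchy (\<sigma> \<circ> r)"
    using T.compactin_imp_mtotally_bounded[of K] K
    unfolding T.mtotally_bounded_sequentially mtopology_of_def by blast
  then obtain N where N: "\<And>n n'. N \<le> n \<Longrightarrow> N \<le> n' \<Longrightarrow> mdist T (\<sigma> (r n)) (\<sigma> (r n')) < \<delta>"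
    using \<open>0 < \<delta>\<close> unfolding T.MCauchy_def by (metis comp_apply)
  obtain m where "r (Suc N) = r N + Suc m"
    using strict_monoD[OF r(1), of N "Suc N"] less_imp_Suc_add by auto
  then show False
    using N[of "Suc N" N] far[of "r N" m] by simp
qed

lemma compactin_mcball_of:
  assumes Y: "mcomplete_of Y" and tb: "Metric_space.mtotally_bounded (mspace Y) (mdist Y) (mcball_of Y y R)"
  shows "compactin (mtopology_of Y) (mcball_of Y y R)"
proof -
  interpret Y: Metric_space "mspace Y" "mdist Y" by simp
  have "compactin Y.mtopology (Y.mtopology closure_of (Y.mcball y R))"
    using Y tb by (simp add: Y.mtotally_bounded_eq_compact_closure_of mcomplete_of_def mcball_of_def)
  moreover have "Y.mtopology closure_of (Y.mcball y R) = Y.mcball y R"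
    by (simp add: closure_of_eq)
  ultimately show ?thesis
    by (simp add: mtopology_of_def mcball_of_def)
qed

text \<open>Total boundedness pulls back along an isometric embedding: the finite nets can be taken
  inside the image of the ball, so they lift. Completeness of \<open>Y\<close> then gives
  compactness.\<close>

lemma compactin_mcball_isometric_embedding:
  assumes f: "isometric_embedding Y T f" and "f y = t" and y: "y \<in> mspace Y" and Y: "mcomplete_of Y"
    and cpt: "compactin (mtopology_of T) (mcball_of T t R)"
  shows "compactin (mtopology_of Y) (mcball_of Y y R)"
proof -
  interpret T: Metric_space "mspace T" "mdist T" by simp
  interpret Y: Metric_space "mspace Y" "mdist Y" by simp
  note fD = isometric_embeddingD[OF f]
  let ?B = "Y.mcball y R"
  have "f ` ?B \<subseteq> T.mcball t R"
    using fD y \<open>f y = t\<close> by (auto simp: T.in_mcball)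
  then have tb: "T.mtotally_bounded (f ` ?B)"
    using cpt T.compactin_imp_mtotally_bounded T.mtotally_bounded_subset
    unfolding mtopology_of_def mcball_of_def by blast
  have "Y.mtotally_bounded ?B"
    unfolding Y.mtotally_bounded_def
  proof (intro strip)
    fix \<epsilon> :: real assume "0 < \<epsilon>"
    then obtain K where K: "finite K" "K \<subseteq> f ` ?B" "f ` ?B \<subseteq> (\<Union>x\<in>K. T.mball x \<epsilon>)"
      using tb unfolding T.mtotally_bounded_def by metis
    obtain K' where K': "K' \<subseteq> ?B" "finite K'" "K = f ` K'"
      using finite_subset_image[OF K(1,2)] by auto
    have "u \<in> (\<Union>x\<in>K'. Y.mball x \<epsilon>)" if "u \<in> ?B" for u
    proof -
      obtain k where "k \<in> K'" "f u \<in> T.mball (f k) \<epsilon>"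
        using K(3) K'(3) \<open>u \<in> ?B\<close> by blast
      then show ?thesis
        using fD(2) \<open>u \<in> ?B\<close> K'(1) by (force simp: T.in_mball)
    qed
    then show "\<exists>K. finite K \<and> K \<subseteq> ?B \<and> ?B \<subseteq> (\<Union>x\<in>K. Y.mball x \<epsilon>)"
      using K' by blast
  qed
  then show ?thesis
    using compactin_mcball_of[OF Y] by (simp add: mcball_of_def)
qed

text \<open>There are embeddings \<open>f\<close> and \<open>g\<close> in both directions. Their
  composition maps each compact ball around \<open>t\<close> isometrically into itself, hence onto,
  and so \<open>f\<close> is onto.\<close>

lemma pointed_GH_limit_unique:
  assumes Y: "pointed_GH_limit X x Y y F" and T: "pointed_GH_limit X x T t F"
    and x: "\<forall>\<^sub>F i in F. x i \<in> mspace (X i)" and "F \<noteq> bot"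
    and "mcomplete_of Y" and cpt: "\<And>R. compactin (mtopology_of T) (mcball_of T t R)"
  shows "pointed_isometric Y y T t"
proof -
  have y: "y \<in> mspace Y" and t: "t \<in> mspace T"
    using Y T by (auto simp: pointed_GH_limit_def)
  obtain f where f: "isometric_embedding Y T f" "f y = t"
    using isometric_embedding_from_approximations[OF y t cpt common_limit_approximation[OF Y T x \<open>F \<noteq> bot\<close>]]
    by blast
  \<comment> \<open>So far only \<open>T\<close> has compact balls; transferring this to
    \<open>Y\<close> along \<open>f\<close> allows the construction of \<open>g\<close>.\<close>
  have cptY: "compactin (mtopology_of Y) (mcball_of Y y R)" for R
    using compactin_mcball_isometric_embedding[OF f y \<open>mcomplete_of Y\<close> cpt] .
  obtain g where g: "isometric_embedding T Y g" "g t = y"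
    using isometric_embedding_from_approximations[OF t y cptY common_limit_approximation[OF T Y x \<open>F \<noteq> bot\<close>]]
    by blast
  note fD = isometric_embeddingD[OF f(1)] and gD = isometric_embeddingD[OF g(1)]
  have "v \<in> f ` mspace Y" if v: "v \<in> mspace T" for v
  proof -
    let ?K = "mcball_of T t (mdist T t v)"
    have "mdist T t (f (g u)) = mdist T t u" if "u \<in> mspace T" for u
      using fD gD f(2) g(2) that t by metis
    then have "(f \<circ> g) ` ?K = ?K"
      using fD gD by (intro isometric_self_map_compact_surj[OF cpt]) auto
    moreover have "v \<in> ?K"
      using v t by simp
    ultimately have "v \<in> (f \<circ> g) ` ?K" by simp
    then show ?thesis
      using gD(1) by auto
  qed
  then show ?thesis
    using f fD(1) unfolding pointed_isometric_def by blast
qed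

section \<open>Gluing along a finite correspondence\<close>

text \<open>
  The two spaces are joined by segments of length \<open>w c\<close> from \<open>\<alpha> c\<close> to \<open>\<beta> c\<close>.  Letting the
  length vary with \<open>c\<close> makes it possible to identify the base points.
\<close>
lemma pointed_GH_dist_le_gluing:
  fixes A :: "'a metric" and B :: "'b metric" and \<alpha> :: "'c \<Rightarrow> 'a" and \<beta> :: "'c \<Rightarrow> 'b"
  assumes C: "finite C" "o' \<in> C" and \<alpha>: "\<And>c. c \<in> C \<Longrightarrow> \<alpha> c \<in> mspace A" and \<beta>: "\<And>c. c \<in> C \<Longrightarrow> \<beta> c \<in> mspace B"
    and w0: "w o' = 0" and wpos: "\<And>c. c \<in> C \<Longrightarrow> c \<noteq> o' \<Longrightarrow> 0 < w c"
    and dis: "\<And>c c'. c \<in> C \<Longrightarrow> c' \<in> C \<Longrightarrow> \<bar>mdist A (\<alpha> c) (\<alpha> c') - mdist B (\<beta> c) (\<beta> c')\<bar> \<le> w c + w c'"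
    and netA: "\<And>u. u \<in> mspace A \<Longrightarrow> \<exists>c\<in>C. mdist A u (\<alpha> c) + w c < e"
    and netB: "\<And>v. v \<in> mspace B \<Longrightarrow> \<exists>c\<in>C. mdist B v (\<beta> c) + w c < e"
  shows "pointed_GH_dist A (\<alpha> o') B (\<beta> o') \<le> ennreal e"
proof -
  have w: "0 \<le> w c" if "c \<in> C" for c
    using w0 wpos[OF that] by (cases "c = o'") auto
  \<comment> \<open>The length of a shortest path from \<open>u\<close> to \<open>v\<close> that
    crosses over on one segment.\<close>
  define cross where "cross u v = Min ((\<lambda>c. mdist A u (\<alpha> c) + w c + mdist B v (\<beta> c)) ` C)" for u v
  have cross_le: "cross u v \<le> mdist A u (\<alpha> c) + w c + mdist B v (\<beta> c)" if "c \<in> C" for u v c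
    unfolding cross_def using C that by (intro Min_le) auto
  have cross_eq: "\<exists>c\<in>C. cross u v = mdist A u (\<alpha> c) + w c + mdist B v (\<beta> c)" for u v
  proof -
    have "cross u v \<in> (\<lambda>c. mdist A u (\<alpha> c) + w c + mdist B v (\<beta> c)) ` C"
      unfolding cross_def using C by (intro Min_in) auto
    then show ?thesis by blast
  qed
  have cross_nonneg: "0 \<le> cross u v" for u v
    using cross_eq[of u v] w by fastforce
  have tA: "mdist A p r \<le> mdist A p q + mdist A q r" if "p \<in> mspace A" "q \<in> mspace A" "r \<in> mspace A" for p q r
    using that by (rule mdist_triangle)
  have tB: "mdist B p r \<le> mdist B p q + mdist B q r" if "p \<in> mspace B" "q \<in> mspace B" "r \<in> mspace B" for p q r
    using that by (rule mdist_triangle)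
  have cross_tA: "cross u v \<le> mdist A u u' + cross u' v" if "u \<in> mspace A" "u' \<in> mspace A" for u u' v
  proof -
    obtain c where c: "c \<in> C" "cross u' v = mdist A u' (\<alpha> c) + w c + mdist B v (\<beta> c)"
      using cross_eq by blast
    then show ?thesis
      using cross_le[of c u v] tA[of u u' "\<alpha> c"] that \<alpha> by auto
  qed
  have cross_tB: "cross u v \<le> mdist B v v' + cross u v'" if "v \<in> mspace B" "v' \<in> mspace B" for u v v'
  proof -
    obtain c where c: "c \<in> C" "cross u v' = mdist A u (\<alpha> c) + w c + mdist B v' (\<beta> c)"
      using cross_eq by blast
    then show ?thesis
      using cross_le[of c u v] tB[of v v' "\<beta> c"] that \<beta> by auto
  qed
  have A_cross: "mdist A u u' \<le> cross u v + cross u' v"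
    if "u \<in> mspace A" "u' \<in> mspace A" "v \<in> mspace B" for u u' v
  proof -
    obtain c where c: "c \<in> C" "cross u v = mdist A u (\<alpha> c) + w c + mdist B v (\<beta> c)"
      using cross_eq by blast
    obtain c' where c': "c' \<in> C" "cross u' v = mdist A u' (\<alpha> c') + w c' + mdist B v (\<beta> c')"
      using cross_eq by blast
    \<comment> \<open>The path from \<open>u\<close> to \<open>u'\<close> uses two segments and a
      stretch in \<open>B\<close> between them. By \<open>dis\<close> these are together at least as
      long as the direct stretch in \<open>A\<close> from \<alpha> c to \<alpha> c'.\<close>
    show ?thesis
      using tA[of u "\<alpha> c" u'] tA[of "\<alpha> c" "\<alpha> c'" u'] tB[of "\<beta> c" v "\<beta> c'"] dis[of c c'] c c' \<alpha> \<beta> that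
      by (auto simp: mdist_commute[of A u'] mdist_commute[of B v])
  qed
  have B_cross: "mdist B v v' \<le> cross u v + cross u v'"
    if "u \<in> mspace A" "v \<in> mspace B" "v' \<in> mspace B" for u v v'
  proof -
    obtain c where c: "c \<in> C" "cross u v = mdist A u (\<alpha> c) + w c + mdist B v (\<beta> c)"
      using cross_eq by blast
    obtain c' where c': "c' \<in> C" "cross u v' = mdist A u (\<alpha> c') + w c' + mdist B v' (\<beta> c')"
      using cross_eq by blast
    show ?thesis
      using tB[of v "\<beta> c" v'] tB[of "\<beta> c" "\<beta> c'" v'] tA[of "\<alpha> c" u "\<alpha> c'"] dis[of c c'] c c' \<alpha> \<beta> that
      by (auto simp: mdist_commute[of A u] mdist_commute[of B v'])
  qed
  let ?a = "\<alpha> o'" and ?b = "\<beta> o'"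
  have a: "?a \<in> mspace A" and b: "?b \<in> mspace B"
    using \<alpha> \<beta> C by auto
  \<comment> \<open>Crossing at \<open>o'\<close> costs nothing, and \<open>dis\<close> with
    \<open>w o' = 0\<close> excludes a shortcut through another segment.\<close>
  have cross_a: "cross ?a v = mdist B ?b v" if "v \<in> mspace B" for v
  proof (rule antisym)
    show "cross ?a v \<le> mdist B ?b v"
      using cross_le[OF C(2), of ?a v] w0 mdist_refl[OF a] by (simp add: mdist_commute)
    obtain c where c: "c \<in> C" "cross ?a v = mdist A ?a (\<alpha> c) + w c + mdist B v (\<beta> c)"
      using cross_eq by blast
    show "mdist B ?b v \<le> cross ?a v"
      using tB[of ?b "\<beta> c" v] dis[OF C(2) c(1)] c b \<beta> w0 that by (simp add: mdist_commute)
  qed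
  have cross_b: "cross u ?b = mdist A ?a u" if "u \<in> mspace A" for u
  proof (rule antisym)
    show "cross u ?b \<le> mdist A ?a u"
      using cross_le[OF C(2), of u ?b] w0 mdist_refl[OF b] by (simp add: mdist_commute)
    obtain c where c: "c \<in> C" "cross u ?b = mdist A u (\<alpha> c) + w c + mdist B ?b (\<beta> c)"
      using cross_eq by blast
    show "mdist A ?a u \<le> cross u ?b"
      using tA[of ?a "\<alpha> c" u] dis[OF C(2) c(1)] c a \<alpha> w0 that by (simp add: mdist_commute)
  qed
  \<comment> \<open>The base points are at distance 0, so that of \<open>B\<close> is left out of
    the carrier and represented by \<open>Inl ?a\<close>.\<close>
  define M where "M = Inl ` mspace A \<union> Inr ` (mspace B - {?b})"
  define D :: "'a + 'b \<Rightarrow> 'a + 'b \<Rightarrow> real" where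
    "D p q = (case p of Inl u \<Rightarrow> (case q of Inl u' \<Rightarrow> mdist A u u' | Inr v \<Rightarrow> cross u v)
                      | Inr v \<Rightarrow> (case q of Inl u \<Rightarrow> cross u v | Inr v' \<Rightarrow> mdist B v v'))" for p q
  have cross_pos: "0 < cross u v" if "u \<in> mspace A" "v \<in> mspace B" "v \<noteq> ?b" for u v
  proof -
    obtain c where c: "c \<in> C" "cross u v = mdist A u (\<alpha> c) + w c + mdist B v (\<beta> c)"
      using cross_eq by blast
    show ?thesis
    proof (cases "c = o'")
      case True
      then have "mdist B v (\<beta> c) \<noteq> 0"
        using that b by simp
      then show ?thesis
        using c w[OF c(1)] mdist_nonneg[of A u "\<alpha> c"] mdist_nonneg[of B v "\<beta> c"] by linarith
    next
      case False
      then show ?thesis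
        using c wpos[OF c(1)] mdist_nonneg[of A u "\<alpha> c"] mdist_nonneg[of B v "\<beta> c"] by linarith
    qed
  qed
  interpret Z: Metric_space M D
  proof
    show "0 \<le> D p q" for p q
      using cross_nonneg by (simp add: D_def split: sum.split)
    show "D p q = D q p" for p q
      by (simp add: D_def mdist_commute split: sum.split)
    show "D p q = 0 \<longleftrightarrow> p = q" if "p \<in> M" "q \<in> M" for p q
      using that cross_pos by (fastforce simp: D_def M_def)
    have M_Inl: "u \<in> mspace A" if "Inl u \<in> M" for u
      using that by (auto simp: M_def)
    have M_Inr: "v \<in> mspace B" if "Inr v \<in> M" for v
      using that by (auto simp: M_def)
    show "D p r \<le> D p q + D q r" if "p \<in> M" "q \<in> M" "r \<in> M" for p q r
    proof (cases p; cases q; cases r)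
      fix u u' u'' assume "p = Inl u" "q = Inl u'" "r = Inl u''"
      then show ?thesis
        using that tA[of u u' u''] by (simp add: D_def M_Inl)
    next
      fix u u' v assume "p = Inl u" "q = Inl u'" "r = Inr v"
      then show ?thesis
        using that cross_tA[of u u' v] by (simp add: D_def M_Inl)
    next
      fix u u' v assume "p = Inl u" "q = Inr v" "r = Inl u'"
      then show ?thesis
        using that A_cross[of u u' v] by (simp add: D_def M_Inl M_Inr)
    next
      fix u v v' assume "p = Inl u" "q = Inr v" "r = Inr v'"
      then show ?thesis
        using that cross_tB[of v' v u] by (simp add: D_def M_Inr mdist_commute add.commute)
    next
      fix u u' v assume "p = Inr v" "q = Inl u" "r = Inl u'"
      then show ?thesis
        using that cross_tA[of u' u v] by (simp add: D_def M_Inl mdist_commute add.commute)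
    next
      fix u v v' assume "p = Inr v" "q = Inl u" "r = Inr v'"
      then show ?thesis
        using that B_cross[of u v v'] by (simp add: D_def M_Inl M_Inr)
    next
      fix u v v' assume "p = Inr v" "q = Inr v'" "r = Inl u"
      then show ?thesis
        using that cross_tB[of v v' u] by (simp add: D_def M_Inr)
    next
      fix v v' v'' assume "p = Inr v" "q = Inr v'" "r = Inr v''"
      then show ?thesis
        using that tB[of v v' v''] by (simp add: D_def M_Inr)
    qed
  qed
  define Z where "Z = metric (M, D)"
  define g where "g v = (if v = ?b then Inl ?a else Inr v)" for v
  have mspaceZ: "mspace Z = M" and mdistZ: "mdist Z = D"
    unfolding Z_def by simp_all
  have f: "isometric_embedding A Z Inl"
    unfolding isometric_embedding_def mspaceZ mdistZ by (auto simp: M_def D_def)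
  have g: "isometric_embedding B Z g"
  proof -
    have "D (g v) (g v') = mdist B v v'" if "v \<in> mspace B" "v' \<in> mspace B" for v v'
      using that a b cross_a mdist_commute[of B v ?b] by (simp add: D_def g_def mdist_refl)
    moreover have "g v \<in> M" if "v \<in> mspace B" for v
      using that a by (simp add: M_def g_def)
    ultimately show ?thesis
      unfolding isometric_embedding_def mspaceZ mdistZ by blast
  qed
  have D_cross: "D (Inl u) (g v) = cross u v" if "u \<in> mspace A" for u v
    using cross_b[OF that] by (simp add: D_def g_def mdist_commute)
  have nearA: "\<exists>v\<in>mspace B. D (Inl u) (g v) < e" if "u \<in> mspace A" for u
  proof -
    obtain c where c: "c \<in> C" "mdist A u (\<alpha> c) + w c < e"
      using netA \<open>u \<in> mspace A\<close> by blast
    then show ?thesis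
      using \<open>u \<in> mspace A\<close> cross_le[OF c(1), of u "\<beta> c"] \<beta>[OF c(1)]
      by (intro bexI[of _ "\<beta> c"]) (auto simp: D_cross mdist_refl)
  qed
  have nearB: "\<exists>u\<in>mspace A. D (Inl u) (g v) < e" if "v \<in> mspace B" for v
  proof -
    obtain c where c: "c \<in> C" "mdist B v (\<beta> c) + w c < e"
      using netB \<open>v \<in> mspace B\<close> by blast
    then show ?thesis
      using cross_le[OF c(1), of "\<alpha> c" v] \<alpha>[OF c(1)]
      by (intro bexI[of _ "\<alpha> c"]) (auto simp: D_cross mdist_refl)
  qed
  have "0 < e"
    using nearA[OF a] Z.nonneg by (meson le_less_trans)
  then have "hausdorff_distance Z (Inl ` mspace A) (g ` mspace B) \<le> ennreal e"
    unfolding hausdorff_distance_def mdistZ using nearA nearB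
    by (intro Inf_lower CollectI exI[of _ e]) auto
  moreover have "pointed_GH_dist A ?a B ?b \<le> hausdorff_distance Z (Inl ` mspace A) (g ` mspace B)"
    unfolding pointed_GH_dist_def
  proof (intro Inf_lower CollectI exI conjI)
    show "Inl ?a = g ?b"
      by (simp add: g_def)
  qed (use f g in auto)
  ultimately show ?thesis
    by (rule order_trans[rotated])
qed

section \<open>The cone metric\<close>

lemma unit_speed_geodesicD:
  assumes "unit_speed_geodesic X x (I, g)"
  shows "0 \<in> I" and "g 0 = x" and "I \<noteq> {0}" and "g \<in> extensional I"
    and "\<And>u. u \<in> I \<Longrightarrow> 0 \<le> u" and "\<And>u. u \<in> I \<Longrightarrow> g u \<in> mspace X"
    and "\<And>u v. v \<in> I \<Longrightarrow> 0 \<le> u \<Longrightarrow> u \<le> v \<Longrightarrow> u \<in> I"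
    and "\<And>u v. u \<in> I \<Longrightarrow> v \<in> I \<Longrightarrow> mdist X (g u) (g v) = \<bar>u - v\<bar>"
proof -
  have g: "is_interval I" "0 \<in> I" "I \<subseteq> {0..}" "I \<noteq> {0}" "g \<in> I \<rightarrow>\<^sub>E mspace X" "g 0 = x"
    "\<forall>s\<in>I. \<forall>t\<in>I. mdist X (g s) (g t) = \<bar>s - t\<bar>"
    using assms by (simp_all add: unit_speed_geodesic_def)
  show "0 \<in> I" "g 0 = x" "I \<noteq> {0}"
    by (fact g)+
  show "g \<in> extensional I" "\<And>u. u \<in> I \<Longrightarrow> g u \<in> mspace X"
    using g(5) by (auto simp: PiE_iff)
  show "\<And>u. u \<in> I \<Longrightarrow> 0 \<le> u"
    using g(3) by auto
  show "\<And>u v. v \<in> I \<Longrightarrow> 0 \<le> u \<Longrightarrow> u \<le> v \<Longrightarrow> u \<in> I"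
    using g(1,2) unfolding is_interval_1 by blast
  show "\<And>u v. u \<in> I \<Longrightarrow> v \<in> I \<Longrightarrow> mdist X (g u) (g v) = \<bar>u - v\<bar>"
    using g(7) by blast
qed

lemma unit_speed_geodesics_comparable:
  assumes "unit_speed_geodesic X x (I, g)" "unit_speed_geodesic X y (J, h)"
  shows "I \<subseteq> J \<or> J \<subseteq> I"
proof (rule ccontr)
  assume "\<not> (I \<subseteq> J \<or> J \<subseteq> I)"
  then obtain u v where "u \<in> I" "u \<notin> J" "v \<in> J" "v \<notin> I" by blast
  then show False
    using unit_speed_geodesicD(5,7)[OF assms(1)] unit_speed_geodesicD(5,7)[OF assms(2)]
    by (metis linorder_le_cases)
qed

lemma unit_speed_imp_geodesic_from_to:
  assumes g: "unit_speed_geodesic X x (I, g)" and u: "u \<in> I"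
  shows "geodesic_from_to X (\<lambda>t. g (t * u)) x (g u)"
proof -
  note D = unit_speed_geodesicD[OF g]
  have tu: "t * u \<in> I" if "t \<in> {0..1}" for t
    using D(7)[OF u, of "t * u"] D(5)[OF u] that by (simp add: mult_left_le_one_le)
  have "mdist X (g (t * u)) (g (s * u)) = \<bar>t - s\<bar> * mdist X x (g u)" if "s \<in> {0..1}" "t \<in> {0..1}" for s t
    using D(8)[OF tu[OF that(2)] tu[OF that(1)]] D(8)[OF D(1) u] D(2) D(5)[OF u]
    by (simp add: abs_mult flip: left_diff_distrib)
  then show ?thesis
    using tu D(2,6) by (auto simp: geodesic_from_to_def)
qed

text \<open>
  \<open>cone_exp x p r\<close> is the exponential map at scale \<open>r\<close>.  Maximal geodesics may have finite
  length, so it is meaningful only for \<open>r \<in> cone_dom x p\<close>.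
\<close>

definition cone_exp :: "'a \<Rightarrow> 'a cone_point \<Rightarrow> real \<Rightarrow> 'a" where
  "cone_exp x p r = snd (cone_path x p) (r * cone_radius p)"

definition cone_dom :: "'a \<Rightarrow> 'a cone_point \<Rightarrow> real set" where
  "cone_dom x p = {r. 0 \<le> r \<and> r * cone_radius p \<in> fst (cone_path x p)}"

locale busemann_concave_at =
  fixes X :: "'a metric" and x :: 'a
  assumes concave: "busemann_concave X" and base: "x \<in> mspace X"
begin

text \<open>A concave function that vanishes at 0 lies above its chord. Concavity of the distance
  enters the whole proof only through this inequality.\<close>

lemma geodesic_contraction:
  assumes "geodesic_from_to X \<gamma>1 x y1" "geodesic_from_to X \<gamma>2 x y2" and t: "0 \<le> t" "t \<le> 1"
  shows "t * mdist X y1 y2 \<le> mdist X (\<gamma>1 t) (\<gamma>2 t)"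
proof -
  have "y1 \<in> mspace X" "y2 \<in> mspace X" and ends: "\<gamma>1 0 = x" "\<gamma>2 0 = x" "\<gamma>1 1 = y1" "\<gamma>2 1 = y2"
    using assms by (auto simp: geodesic_from_to_def Pi_iff)
  then have "concave_on {0..1} (\<lambda>t. mdist X (\<gamma>1 t) (\<gamma>2 t))"
    using assms concave base unfolding busemann_concave_def by blast
  then have "(1 - t) * mdist X (\<gamma>1 0) (\<gamma>2 0) + t * mdist X (\<gamma>1 1) (\<gamma>2 1)
      \<le> mdist X (\<gamma>1 ((1 - t) *\<^sub>R 0 + t *\<^sub>R 1)) (\<gamma>2 ((1 - t) *\<^sub>R 0 + t *\<^sub>R 1))"
    by (rule concave_onD) (use t in auto)
  then show ?thesis
    using ends mdist_refl[OF base] by simp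
qed

lemma Apex_in_precone [simp]: "Apex \<in> precone_points X x"
  by (simp add: precone_points_def)

lemma precone_points_cases:
  assumes "p \<in> precone_points X x"
  obtains "p = Apex"
    | I g s where "p = Ray (I, g) s" "0 < s" "(I, g) \<in> maximal_geodesics X x" "unit_speed_geodesic X x (I, g)"
proof (cases p)
  case (Ray \<gamma> s)
  moreover obtain I g where "\<gamma> = (I, g)"
    by (cases \<gamma>)
  ultimately show ?thesis
    using assms that(2)[of I g s] by (simp add: precone_points_def maximal_geodesics_def)
qed (use that(1) in blast)

lemma cone_radius_nonneg: "p \<in> precone_points X x \<Longrightarrow> 0 \<le> cone_radius p"
  by (erule precone_points_cases) auto

text \<open>Makes the choice of \<open>a\<close> in \<open>precone_dist\<close> meaningful; the
  exclusion of the domain \<open>{0}\<close> is used here.\<close>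

lemma cone_path_dom:
  assumes "p \<in> precone_points X x"
  shows "\<exists>a>0. {0..a} \<subseteq> fst (cone_path x p)"
  using assms
proof (cases rule: precone_points_cases)
  case 1
  then show ?thesis by (auto intro: exI[of _ 1])
next
  case (2 I g s)
  then obtain a where "a \<in> I" "a \<noteq> 0"
    using unit_speed_geodesicD(1,3)[OF 2(4)] by blast
  then have "0 < a" "{0..a} \<subseteq> I"
    using unit_speed_geodesicD(5)[OF 2(4), of a] unit_speed_geodesicD(7)[OF 2(4), of a] by auto
  then show ?thesis
    using 2(1) by auto
qed

lemma geodesic_cone_exp:
  assumes "p \<in> precone_points X x" and r: "r \<in> cone_dom x p"
  shows "geodesic_from_to X (\<lambda>t. cone_exp x p (t * r)) x (cone_exp x p r)"
  using assms(1)
proof (cases rule: precone_points_cases)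
  case 1
  then show ?thesis
    using base by (auto simp: cone_exp_def geodesic_from_to_def mdist_refl)
next
  case (2 I g s)
  then have "r * s \<in> I"
    using r by (simp add: cone_dom_def)
  from unit_speed_imp_geodesic_from_to[OF 2(4) this] show ?thesis
    using 2(1) by (simp add: cone_exp_def mult.assoc)
qed

lemma cone_exp_in: "p \<in> precone_points X x \<Longrightarrow> r \<in> cone_dom x p \<Longrightarrow> cone_exp x p r \<in> mspace X"
  using geodesic_cone_exp[of p r] PiE[of "\<lambda>t. cone_exp x p (t * r)" "{0..1}" "\<lambda>_. mspace X" 1]
  by (simp add: geodesic_from_to_def)

lemma mdist_cone_exp:
  assumes "p \<in> precone_points X x" and r: "r \<in> cone_dom x p"
  shows "mdist X x (cone_exp x p r) = r * cone_radius p"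
  using assms(1)
proof (cases rule: precone_points_cases)
  case 1
  then show ?thesis
    using base by (simp add: cone_exp_def mdist_refl)
next
  case (2 I g s)
  then have "r * s \<in> I" "0 \<le> r"
    using r by (auto simp: cone_dom_def)
  then show ?thesis
    using unit_speed_geodesicD(1,2,8)[OF 2(4)] 2 by (metis abs_minus_commute abs_of_nonneg cone_exp_def
      cone_path.simps(2) cone_radius.simps(2) diff_zero less_eq_real_def mult_nonneg_nonneg snd_conv)
qed

lemma cone_dom_downward:
  assumes "p \<in> precone_points X x" and r: "r \<in> cone_dom x p" and r': "0 \<le> r'" "r' \<le> r"
  shows "r' \<in> cone_dom x p"
  using assms(1)
proof (cases rule: precone_points_cases)
  case 1
  then show ?thesis
    using r' by (simp add: cone_dom_def)
next
  case (2 I g s)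
  then have "r * s \<in> I" "r' * s \<le> r * s"
    using r r' by (auto simp: cone_dom_def mult_right_mono)
  then show ?thesis
    using unit_speed_geodesicD(7)[OF 2(4)] 2 r' by (simp add: cone_dom_def)
qed

lemma eventually_in_cone_dom:
  assumes "p \<in> precone_points X x"
  shows "\<forall>\<^sub>F r in at_right 0. r \<in> cone_dom x p"
proof -
  obtain a where a: "0 < a" "{0..a} \<subseteq> fst (cone_path x p)"
    using cone_path_dom[OF assms] by blast
  \<comment> \<open>The added 1 avoids a division by 0 at the apex.\<close>
  define b where "b = a / (cone_radius p + 1)"
  have s: "0 \<le> cone_radius p"
    by (rule cone_radius_nonneg[OF assms])
  then have "0 < b" "b * cone_radius p \<le> a"
    using a(1) by (auto simp: b_def field_simps)
  then have "b \<in> cone_dom x p"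
    using a(2) s by (auto simp: cone_dom_def)
  then have "r \<in> cone_dom x p" if "0 < r" "r < b" for r
    using cone_dom_downward[OF assms, of b r] that by simp
  then show ?thesis
    using \<open>0 < b\<close> by (auto simp: eventually_at_right_field)
qed

section \<open>The cone distance as a limit of difference quotients\<close>

definition quot :: "'a cone_point \<Rightarrow> 'a cone_point \<Rightarrow> real \<Rightarrow> real" where
  "quot p q r = mdist X (cone_exp x p r) (cone_exp x q r) / r"

text \<open>Contraction with parameter \<open>r' / r\<close>, applied to the two geodesics run up to
  scale \<open>r\<close>.\<close>

lemma quot_antimono:
  assumes p: "p \<in> precone_points X x" and q: "q \<in> precone_points X x"
    and r: "r \<in> cone_dom x p" "r \<in> cone_dom x q" and r': "0 < r'" "r' \<le> r"
  shows "quot p q r \<le> quot p q r'"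
proof -
  have "(r' / r) * mdist X (cone_exp x p r) (cone_exp x q r)
      \<le> mdist X (cone_exp x p (r' / r * r)) (cone_exp x q (r' / r * r))"
    using geodesic_contraction[OF geodesic_cone_exp[OF p r(1)] geodesic_cone_exp[OF q r(2)], of "r' / r"] r'
    by simp
  then show ?thesis
    using r' by (simp add: quot_def field_simps)
qed

text \<open>Frees the supremum from the chosen \<open>a\<close> and from the restriction to scales
  at most 1: the quotients grow as the scale shrinks, so only small scales matter.\<close>

lemma precone_dist_sup:
  assumes p: "p \<in> precone_points X x" and q: "q \<in> precone_points X x"
  shows "\<And>r. r \<in> cone_dom x p \<Longrightarrow> r \<in> cone_dom x q \<Longrightarrow> 0 < r \<Longrightarrow> quot p q r \<le> precone_dist X x p q"
    and "\<And>e. 0 < e \<Longrightarrow> \<exists>r>0. r \<in> cone_dom x p \<and> r \<in> cone_dom x q \<and> precone_dist X x p q - e < quot p q r"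
proof -
  define s t where "s = cone_radius p" and "t = cone_radius q"
  define I J where "I = fst (cone_path x p)" and "J = fst (cone_path x q)"
  define a where "a = (SOME a. 0 < a \<and> {0..a} \<subseteq> I \<inter> J)"
  obtain b c where bc: "0 < b" "{0..b} \<subseteq> I" "0 < c" "{0..c} \<subseteq> J"
    using cone_path_dom[OF p] cone_path_dom[OF q] unfolding I_def J_def by blast
  then have "0 < min b c \<and> {0..min b c} \<subseteq> I \<inter> J"
    by auto
  then have a: "0 < a" "{0..a} \<subseteq> I \<inter> J"
    using someI[of "\<lambda>a. 0 < a \<and> {0..a} \<subseteq> I \<inter> J" "min b c"] unfolding a_def by auto
  define S where "S = {r. 0 < r \<and> r \<le> 1 \<and> max (r * s) (r * t) \<le> a}"
  have D: "precone_dist X x p q = (SUP r\<in>S. quot p q r)"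
    using p q unfolding precone_dist_def quot_def cone_exp_def S_def a_def I_def J_def s_def t_def
    by (simp add: case_prod_beta Let_def)
  have s: "0 \<le> s" and t: "0 \<le> t"
    unfolding s_def t_def by (simp_all add: cone_radius_nonneg p q)
  have S_dom: "r \<in> cone_dom x p" "r \<in> cone_dom x q" "0 < r" if "r \<in> S" for r
    using that a(2) s t unfolding cone_dom_def S_def s_def[symmetric] t_def[symmetric] I_def[symmetric] J_def[symmetric]
    by (auto simp: subset_iff)
  \<comment> \<open>All scales up to this \<open>b\<close> lie in \<open>S\<close>; the denominator
    is positive even if both radii vanish.\<close>
  define b where "b = min 1 (a / (s + t + 1))"
  have "0 < b" "b * s \<le> a" "b * t \<le> a" "b \<le> 1"
  proof -
    show "0 < b" "b \<le> 1"
      using a(1) s t by (auto simp: b_def)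
    have "b * (s + t + 1) \<le> a / (s + t + 1) * (s + t + 1)"
      using s t by (intro mult_right_mono) (auto simp: b_def)
    also have "a / (s + t + 1) * (s + t + 1) = a"
      using s t by simp
    finally have "b * s + b * t + b \<le> a"
      by (simp add: distrib_left)
    moreover have "0 \<le> b * s" "0 \<le> b * t"
      using \<open>0 < b\<close> s t by simp_all
    ultimately show "b * s \<le> a" "b * t \<le> a"
      using \<open>0 < b\<close> by linarith+
  qed
  then have S: "r \<in> S" if "0 < r" "r \<le> b" for r
    using that s t mult_right_mono[OF that(2) s] mult_right_mono[OF that(2) t] by (auto simp: S_def)
  \<comment> \<open>The detour through \<open>x\<close> bounds the quotients by
    \<open>s + t\<close>, as a supremum of reals requires.\<close>
  have bdd: "bdd_above (quot p q ` S)"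
  proof (rule bdd_aboveI2)
    fix r assume "r \<in> S"
    note r = S_dom[OF this]
    have "mdist X (cone_exp x p r) (cone_exp x q r) \<le> r * s + r * t"
      using mdist_triangle[OF cone_exp_in[OF p r(1)] base cone_exp_in[OF q r(2)]]
        mdist_cone_exp[OF p r(1)] mdist_cone_exp[OF q r(2)]
      by (simp add: mdist_commute s_def t_def)
    then show "quot p q r \<le> s + t"
      using r(3) by (simp add: quot_def field_simps)
  qed
  show "quot p q r \<le> precone_dist X x p q" if "r \<in> cone_dom x p" "r \<in> cone_dom x q" "0 < r" for r
  proof -
    \<comment> \<open>A scale that may be outside \<open>S\<close> is lowered into \<open>S\<close>,
      which cannot decrease the quotient.\<close>
    have "quot p q r \<le> quot p q (min r b)"
      using that \<open>0 < b\<close> by (intro quot_antimono[OF p q]) auto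
    also have "\<dots> \<le> precone_dist X x p q"
      unfolding D using that \<open>0 < b\<close> by (intro cSUP_upper S bdd) auto
    finally show ?thesis .
  qed
  show "\<exists>r>0. r \<in> cone_dom x p \<and> r \<in> cone_dom x q \<and> precone_dist X x p q - e < quot p q r" if "0 < e" for e
  proof -
    have "S \<noteq> {}"
      using S[of b] \<open>0 < b\<close> by auto
    then have "\<exists>r\<in>S. precone_dist X x p q - e < quot p q r"
      unfolding D using less_cSUP_iff[OF _ bdd, of "(SUP r\<in>S. quot p q r) - e"] that by simp
    then show ?thesis
      using S_dom by blast
  qed
qed

lemma tendsto_quot:
  assumes p: "p \<in> precone_points X x" and q: "q \<in> precone_points X x"
  shows "(quot p q \<longlongrightarrow> precone_dist X x p q) (at_right 0)"
proof (rule tendstoI)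
  fix e :: real assume "0 < e"
  then obtain r where r: "0 < r" "r \<in> cone_dom x p" "r \<in> cone_dom x q" "precone_dist X x p q - e < quot p q r"
    using precone_dist_sup(2)[OF p q] by blast
  have "dist (quot p q r') (precone_dist X x p q) < e" if "0 < r'" "r' < r" for r'
  proof -
    have "quot p q r \<le> quot p q r'"
      using that r by (intro quot_antimono[OF p q]) auto
    moreover have "quot p q r' \<le> precone_dist X x p q"
      using that r cone_dom_downward[OF p r(2)] cone_dom_downward[OF q r(3)] by (intro precone_dist_sup(1)[OF p q]) auto
    ultimately show ?thesis
      using r(4) by (simp add: dist_real_def)
  qed
  then show "\<forall>\<^sub>F r in at_right 0. dist (quot p q r) (precone_dist X x p q) < e"
    using r(1) by (auto simp: eventually_at_right_field)
qed

lemma precone_dist_unique: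
  assumes "p \<in> precone_points X x" "q \<in> precone_points X x" "(quot p q \<longlongrightarrow> l) (at_right 0)"
  shows "precone_dist X x p q = l"
  using tendsto_unique[OF trivial_limit_at_right_real tendsto_quot[OF assms(1,2)] assms(3)] .

lemma precone_dist_Apex:
  assumes p: "p \<in> precone_points X x"
  shows "precone_dist X x Apex p = cone_radius p"
proof (rule precone_dist_unique[OF Apex_in_precone p])
  have "\<forall>\<^sub>F r in at_right 0. 0 < r \<and> r \<in> cone_dom x p"
    using eventually_in_cone_dom[OF p] eventually_at_right_less[of "0::real"] by eventually_elim auto
  then have "\<forall>\<^sub>F r in at_right 0. cone_radius p = quot Apex p r"
  proof eventually_elim
    case (elim r)
    then show ?case
      using mdist_cone_exp[OF p, of r] by (simp add: quot_def cone_exp_def[of _ Apex])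
  qed
  then show "(quot Apex p \<longlongrightarrow> cone_radius p) (at_right 0)"
    by (rule Lim_transform_eventually[OF tendsto_const])
qed

text \<open>The distance 0 bounds all quotients, so the two exponential maps agree wherever both are
  defined. A common scale gives equal radii, and maximality identifies the domains.\<close>

lemma precone_dist_eq_0_imp_eq:
  assumes p: "p \<in> precone_points X x" and q: "q \<in> precone_points X x" and D0: "precone_dist X x p q = 0"
  shows "p = q"
proof -
  have eq: "cone_exp x p r = cone_exp x q r" if "0 < r" "r \<in> cone_dom x p" "r \<in> cone_dom x q" for r
  proof -
    have "mdist X (cone_exp x p r) (cone_exp x q r) \<le> 0"
      using precone_dist_sup(1)[OF p q that(2,3,1)] D0 that(1) by (simp add: quot_def divide_le_0_iff)
    then show ?thesis
      using mdist_nonneg[of X "cone_exp x p r" "cone_exp x q r"]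
        mdist_zero[OF cone_exp_in[OF p that(2)] cone_exp_in[OF q that(3)]] by linarith
  qed
  have "\<forall>\<^sub>F r in at_right 0. 0 < r \<and> r \<in> cone_dom x p \<and> r \<in> cone_dom x q"
    using eventually_in_cone_dom[OF p] eventually_in_cone_dom[OF q] eventually_at_right_less[of "0::real"]
    by eventually_elim auto
  then obtain r where r: "0 < r" "r \<in> cone_dom x p" "r \<in> cone_dom x q"
    using eventually_happens'[OF trivial_limit_at_right_real] by blast
  then have rad: "cone_radius p = cone_radius q"
    using mdist_cone_exp[OF p r(2)] mdist_cone_exp[OF q r(3)] eq[OF r] by simp
  show ?thesis
    using p
  proof (cases rule: precone_points_cases)
    case 1
    show ?thesis
      using q rad 1 by (cases rule: precone_points_cases) auto
  next
    case P: (2 I g s)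
    show ?thesis
      using q
    proof (cases rule: precone_points_cases)
      case 1
      then show ?thesis
        using rad P by simp
    next
      case Q: (2 J h t)
      have "t = s"
        using rad P Q by simp
      have gh: "g u = h u" if "u \<in> I" "u \<in> J" for u
      proof (cases "u = 0")
        case True
        then show ?thesis
          using unit_speed_geodesicD(2)[OF P(4)] unit_speed_geodesicD(2)[OF Q(4)] by simp
      next
        case False
        then have "0 < u"
          using unit_speed_geodesicD(5)[OF P(4)] that(1) by force
        then show ?thesis
          using eq[of "u / s"] that P Q \<open>t = s\<close> by (simp add: cone_dom_def cone_exp_def)
      qed
      \<comment> \<open>The geodesic with the larger domain extends the other one, which is
        maximal.\<close>
      have "I = J"
        using unit_speed_geodesics_comparable[OF P(4) Q(4)]
      proof
        assume "I \<subseteq> J"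
        then show ?thesis
          using P(3) Q(4) gh unfolding maximal_geodesics_def mem_Collect_eq prod.case by (metis subsetD)
      next
        assume "J \<subseteq> I"
        then show ?thesis
          using Q(3) P(4) gh unfolding maximal_geodesics_def mem_Collect_eq prod.case by (metis subsetD)
      qed
      then have "g = h"
        using gh unit_speed_geodesicD(4)[OF P(4)] unit_speed_geodesicD(4)[OF Q(4)] by (metis extensionalityI)
      then show ?thesis
        using P Q \<open>t = s\<close> \<open>I = J\<close> by simp
    qed
  qed
qed

text \<open>Nonnegativity, symmetry and the triangle inequality hold for the quotients at each small
  scale and pass to the limit.\<close>

lemma Metric_space_precone: "Metric_space (precone_points X x) (precone_dist X x)"
proof
  show nonneg: "0 \<le> precone_dist X x p q" for p q
  proof (cases "p \<in> precone_points X x \<and> q \<in> precone_points X x")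
    case True
    have "\<forall>\<^sub>F r in at_right 0. 0 \<le> quot p q r"
      using eventually_at_right_less[of "0::real"] by eventually_elim (simp add: quot_def)
    then show ?thesis
      using tendsto_lowerbound[OF tendsto_quot] True by simp
  qed (auto simp: precone_dist_def)
  show "precone_dist X x p q = precone_dist X x q p" for p q
  proof (cases "p \<in> precone_points X x \<and> q \<in> precone_points X x")
    case True
    have "quot p q = quot q p"
      by (simp add: fun_eq_iff quot_def mdist_commute)
    then show ?thesis
      using precone_dist_unique[of p q] tendsto_quot[of q p] True by simp
  qed (auto simp: precone_dist_def)
  show "precone_dist X x p q = 0 \<longleftrightarrow> p = q" if p: "p \<in> precone_points X x" and q: "q \<in> precone_points X x" for p q
  proof
    assume "p = q"
    have "\<forall>\<^sub>F r in at_right 0. 0 = quot p p r"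
      using eventually_in_cone_dom[OF p] by eventually_elim (simp add: quot_def mdist_refl cone_exp_in[OF p])
    then have "(quot p p \<longlongrightarrow> 0) (at_right 0)"
      by (rule Lim_transform_eventually[OF tendsto_const])
    then show "precone_dist X x p q = 0"
      using precone_dist_unique p \<open>p = q\<close> by blast
  qed (rule precone_dist_eq_0_imp_eq[OF p q])
  show "precone_dist X x p u \<le> precone_dist X x p q + precone_dist X x q u"
    if p: "p \<in> precone_points X x" and q: "q \<in> precone_points X x" and u: "u \<in> precone_points X x" for p q u
  proof (rule tendsto_le[OF trivial_limit_at_right_real tendsto_add[OF tendsto_quot[OF p q] tendsto_quot[OF q u]]
          tendsto_quot[OF p u]])
    show "\<forall>\<^sub>F r in at_right 0. quot p u r \<le> quot p q r + quot q u r"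
      using eventually_in_cone_dom[OF p] eventually_in_cone_dom[OF q] eventually_in_cone_dom[OF u]
        eventually_at_right_less[of "0::real"]
    proof eventually_elim
      case (elim r)
      then have "mdist X (cone_exp x p r) (cone_exp x u r)
          \<le> mdist X (cone_exp x p r) (cone_exp x q r) + mdist X (cone_exp x q r) (cone_exp x u r)"
        using p q u by (intro mdist_triangle cone_exp_in)
      then show ?case
        using elim by (simp add: quot_def divide_right_mono flip: add_divide_distrib)
    qed
  qed
qed

lemma mspace_precone [simp]: "mspace (precone X x) = precone_points X x"
  and mdist_precone [simp]: "mdist (precone X x) = precone_dist X x"
  unfolding precone_def
  using Metric_space.mspace_metric[OF Metric_space_precone] Metric_space.mdist_metric[OF Metric_space_precone]
  by simp_all

section \<open>Maximal geodesics and surjectivity of the exponential map\<close>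

text \<open>
  Concavity excludes branching, so the extensions of a given geodesic agree with each other and
  their union is the maximal one.
\<close>

lemma exists_maximal_geodesic:
  assumes y: "y \<in> mspace X" and "y \<noteq> x"
  shows "\<exists>I g. (I, g) \<in> maximal_geodesics X x \<and> mdist X x y \<in> I \<and> g (mdist X x y) = y"
proof -
  define l where "l = mdist X x y"
  have "0 < l"
    using mdist_zero[OF base y] assms(2) mdist_nonneg[of X x y] by (auto simp: l_def less_le)
  obtain \<gamma> where \<gamma>: "geodesic_from_to X \<gamma> x y"
    using concave base y unfolding busemann_concave_def geodesic_metric_def by blast
  define g0 where "g0 = (\<lambda>u\<in>{0..l}. \<gamma> (u / l))"
  have "mdist X (g0 u) (g0 v) = \<bar>u - v\<bar>" if "u \<in> {0..l}" "v \<in> {0..l}" for u v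
  proof -
    have "mdist X (\<gamma> (u / l)) (\<gamma> (v / l)) = \<bar>u / l - v / l\<bar> * l"
      using \<gamma> that \<open>0 < l\<close> unfolding geodesic_from_to_def l_def[symmetric] by simp
    also have "\<dots> = \<bar>u - v\<bar>"
      using \<open>0 < l\<close> by (simp flip: diff_divide_distrib)
    finally show ?thesis
      using that by (simp add: g0_def)
  qed
  moreover have "g0 \<in> {0..l} \<rightarrow>\<^sub>E mspace X" "g0 0 = x"
    using \<gamma> \<open>0 < l\<close> by (auto simp: g0_def geodesic_from_to_def Pi_iff)
  ultimately have g0: "unit_speed_geodesic X x ({0..l}, g0)"
    using \<open>0 < l\<close> by (auto simp: unit_speed_geodesic_def is_interval_cc)
  define E where "E = {(J, h). unit_speed_geodesic X x (J, h) \<and> {0..l} \<subseteq> J \<and> (\<forall>u\<in>{0..l}. h u = g0 u)}"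
  have E: "unit_speed_geodesic X x (J, h)" "{0..l} \<subseteq> J" "\<And>u. u \<in> {0..l} \<Longrightarrow> h u = g0 u" if "(J, h) \<in> E" for J h
    using that by (auto simp: E_def)
  have agree: "h u = h' u" if h: "(J, h) \<in> E" and h': "(J', h') \<in> E" and u: "u \<in> J" "u \<in> J'" for J h J' h' u
  proof (cases "u \<le> l")
    case True
    then have "u \<in> {0..l}"
      using unit_speed_geodesicD(5)[OF E(1)[OF h] u(1)] by simp
    then show ?thesis
      using E(3)[OF h] E(3)[OF h'] by simp
  next
    case False
    \<comment> \<open>Both extensions pass through \<open>g0 l\<close>, so contraction from
      \<open>u\<close> to \<open>l\<close> forces them to meet at \<open>u\<close>.\<close>
    have "l / u * mdist X (h u) (h' u) \<le> mdist X (h (l / u * u)) (h' (l / u * u))"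
      using False \<open>0 < l\<close>
      by (intro geodesic_contraction[OF unit_speed_imp_geodesic_from_to[OF E(1)[OF h] u(1)]
            unit_speed_imp_geodesic_from_to[OF E(1)[OF h'] u(2)]]) auto
    also have "\<dots> = mdist X (g0 l) (g0 l)"
      using False \<open>0 < l\<close> E(3)[OF h] E(3)[OF h'] by simp
    also have "\<dots> = 0"
      using \<open>0 < l\<close> unit_speed_geodesicD(6)[OF g0] by (simp add: mdist_refl)
    finally have "mdist X (h u) (h' u) \<le> 0"
      using False \<open>0 < l\<close> by (simp add: mult_le_0_iff divide_le_0_iff)
    then show ?thesis
      using unit_speed_geodesicD(6)[OF E(1)[OF h] u(1)] unit_speed_geodesicD(6)[OF E(1)[OF h'] u(2)]
        mdist_nonneg[of X "h u" "h' u"] mdist_zero[of "h u" X "h' u"] by auto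
  qed
  define I where "I = (\<Union>(J, h)\<in>E. J)"
  define g where "g = (\<lambda>u\<in>I. THE v. \<exists>J h. (J, h) \<in> E \<and> u \<in> J \<and> v = h u)"
  have g: "g u = h u" "u \<in> I" if "(J, h) \<in> E" "u \<in> J" for J h u
  proof -
    show "u \<in> I"
      using that by (auto simp: I_def)
    moreover have "(THE v. \<exists>J h. (J, h) \<in> E \<and> u \<in> J \<and> v = h u) = h u"
      using that agree by (intro the_equality) blast+
    ultimately show "g u = h u"
      by (simp add: g_def)
  qed
  have g0E: "({0..l}, g0) \<in> E"
    using g0 by (simp add: E_def)
  \<comment> \<open>The domains are nested, so a condition on two parameters can be checked in one
    extension.\<close>
  have two: "\<exists>J h. (J, h) \<in> E \<and> u \<in> J \<and> v \<in> J" if "u \<in> I" "v \<in> I" for u v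
  proof -
    from that obtain J h J' h' where JJ: "(J, h) \<in> E" "u \<in> J" "(J', h') \<in> E" "v \<in> J'"
      unfolding I_def by blast
    then show ?thesis
      using unit_speed_geodesics_comparable[OF E(1)[OF JJ(1)] E(1)[OF JJ(3)]] by blast
  qed
  have "unit_speed_geodesic X x (I, g)"
    unfolding unit_speed_geodesic_def prod.case
  proof (intro conjI ballI)
    have nonneg: "0 \<le> u" if "u \<in> I" for u
      using two[OF that that] unit_speed_geodesicD(5)[OF E(1)] by blast
    then show "I \<subseteq> {0..}" by auto
    show "is_interval I"
      unfolding is_interval_1
    proof (intro ballI allI impI)
      fix a b u assume "a \<in> I" "b \<in> I" "a \<le> u \<and> u \<le> b"
      moreover obtain J h where J: "(J, h) \<in> E" "b \<in> J"
        using \<open>b \<in> I\<close> by (auto simp: I_def)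
      ultimately have "u \<in> J"
        using nonneg[of a] unit_speed_geodesicD(7)[OF E(1)[OF J(1)] J(2), of u] by simp
      then show "u \<in> I"
        using g(2) J(1) by blast
    qed
    show "0 \<in> I" "g 0 = x"
      using g[OF g0E, of 0] \<open>0 < l\<close> unit_speed_geodesicD(2)[OF g0] by auto
    show "I \<noteq> {0}"
      using g(2)[OF g0E, of l] \<open>0 < l\<close> by auto
    show "g \<in> I \<rightarrow>\<^sub>E mspace X"
    proof (rule PiE_I)
      fix u assume "u \<in> I"
      then obtain J h where "(J, h) \<in> E" "u \<in> J"
        using two by blast
      then show "g u \<in> mspace X"
        using g(1) unit_speed_geodesicD(6)[OF E(1)] by metis
    qed (simp add: g_def)
    fix u v assume "u \<in> I" "v \<in> I"
    then obtain J h where "(J, h) \<in> E" "u \<in> J" "v \<in> J"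
      using two by blast
    then show "mdist X (g u) (g v) = \<bar>u - v\<bar>"
      using g(1) unit_speed_geodesicD(8)[OF E(1)] by metis
  qed
  \<comment> \<open>An extension of \<open>g\<close> is itself a member of \<open>E\<close>, so its
    domain is part of the union \<open>I\<close>.\<close>
  moreover have "J = I" if J: "unit_speed_geodesic X x (J, h)" "I \<subseteq> J" "\<forall>u\<in>I. h u = g u" for J h
  proof -
    have "{0..l} \<subseteq> I"
      using g(2)[OF g0E] by blast
    moreover have "h u = g0 u" if "u \<in> {0..l}" for u
      using J(3) g[OF g0E that] by simp
    ultimately have "(J, h) \<in> E"
      using J(1,2) by (auto simp: E_def)
    then show ?thesis
      using J(2) g(2) by blast
  qed
  ultimately have "(I, g) \<in> maximal_geodesics X x"
    by (auto simp: maximal_geodesics_def)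
  moreover have "l \<in> I" "g l = y"
    using g[OF g0E, of l] \<gamma> \<open>0 < l\<close> by (auto simp: g0_def geodesic_from_to_def)
  ultimately show ?thesis
    unfolding l_def by blast
qed

text \<open>For \<open>y\<close> other than \<open>x\<close>, a maximal geodesic through
  \<open>y\<close> serves as the ray. The radius is the distance from \<open>x\<close> to
  \<open>y\<close> in the blow-up by \<open>r\<close>, so points of a ball of the blow-up come from
  the cone ball of the same radius.\<close>

lemma cone_exp_surj:
  assumes y: "y \<in> mspace X" and "0 < r"
  shows "\<exists>p\<in>precone_points X x. r \<in> cone_dom x p \<and> cone_exp x p r = y \<and> cone_radius p = mdist X x y / r"
proof (cases "y = x")
  case True
  then show ?thesis
    using \<open>0 < r\<close> y by (intro bexI[of _ Apex]) (auto simp: cone_dom_def cone_exp_def mdist_refl)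
next
  case False
  then obtain I g where Ig: "(I, g) \<in> maximal_geodesics X x" "mdist X x y \<in> I" "g (mdist X x y) = y"
    using exists_maximal_geodesic[OF y] by blast
  have "0 < mdist X x y"
    using False mdist_zero[OF base y] mdist_nonneg[of X x y] by (auto simp: less_le)
  then have "Ray (I, g) (mdist X x y / r) \<in> precone_points X x"
    using Ig(1) \<open>0 < r\<close> by (auto simp: precone_points_def)
  then show ?thesis
    using Ig \<open>0 < r\<close> by (intro bexI[of _ "Ray (I, g) (mdist X x y / r)"]) (auto simp: cone_dom_def cone_exp_def)
qed

end

section \<open>Doubling and blow-ups\<close>

text \<open>Halving the radius \<open>k\<close> times covers the part of the ball that meets
  \<open>S\<close> by at most \<open>N ^ k\<close> balls of radius \<open>r / 2 ^ k\<close>, each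
  with at most one point of \<open>S\<close>. The margin \<open>3 * r\<close> survives a halving:
  the centre of a covering ball that meets \<open>S\<close> is within \<open>3 * r / 2\<close> of
  \<open>y\<close>.\<close>

lemma card_separated_le:
  assumes doubling: "\<And>y r. y \<in> mball_of X x R \<Longrightarrow> 0 < r \<Longrightarrow> r \<le> R \<Longrightarrow>
      \<exists>C. C \<subseteq> mspace X \<and> finite C \<and> card C \<le> N \<and> mball_of X y r \<subseteq> (\<Union>c\<in>C. mball_of X c (r / 2))"
    and x: "x \<in> mspace X" and y: "y \<in> mspace X" and r: "0 < r" "mdist X x y + 3 * r \<le> R"
    and S: "S \<subseteq> mball_of X y r" and sep: "\<And>u v. u \<in> S \<Longrightarrow> v \<in> S \<Longrightarrow> u \<noteq> v \<Longrightarrow> 2 * r / 2 ^ k \<le> mdist X u v"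
  shows "finite S \<and> card S \<le> N ^ k"
  using y r S sep
proof (induction k arbitrary: y r S)
  case 0
  \<comment> \<open>Two points of a ball of radius \<open>r\<close> are less than
    \<open>2 * r\<close> apart.\<close>
  have "u = v" if "u \<in> S" "v \<in> S" for u v
  proof (rule ccontr)
    assume "u \<noteq> v"
    have "mdist X y u < r" "mdist X y v < r" "u \<in> mspace X" "v \<in> mspace X"
      using that "0.prems"(4) by auto
    then show False
      using "0.prems"(5)[OF that \<open>u \<noteq> v\<close>] mdist_triangle[of u X y v] "0.prems"(1) by (simp add: mdist_commute)
  qed
  then obtain u where "S \<subseteq> {u}"
    by blast
  then have "finite S" "card S \<le> card {u}"
    by (auto intro: finite_subset card_mono simp del: card.insert)
  then show ?case by simp
next
  case (Suc k)
  have "y \<in> mball_of X x R" "r \<le> R"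
    using Suc.prems(1-3) x mdist_nonneg[of X x y] unfolding in_mball_of by linarith+
  then obtain C where C: "C \<subseteq> mspace X" "finite C" "card C \<le> N" "mball_of X y r \<subseteq> (\<Union>c\<in>C. mball_of X c (r / 2))"
    using doubling[of y r] Suc.prems(2) by blast
  have piece: "finite (S \<inter> mball_of X c (r / 2)) \<and> card (S \<inter> mball_of X c (r / 2)) \<le> N ^ k" if "c \<in> C" for c
  \<comment> \<open>A covering ball that misses \<open>S\<close> contributes nothing, while its
    centre may violate the margin.\<close>
  proof (cases "S \<inter> mball_of X c (r / 2) = {}")
    case False
    then obtain u where u: "u \<in> S" "u \<in> mspace X" "mdist X c u < r / 2" by auto
    then have "mdist X y u < r"
      using Suc.prems(4) by auto
    have c: "c \<in> mspace X"
      using C that by blast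
    have "mdist X x c \<le> mdist X x y + mdist X y u + mdist X c u"
      using mdist_triangle[OF x Suc.prems(1) c] mdist_triangle[OF Suc.prems(1) u(2) c] by (simp add: mdist_commute)
    then have "mdist X x c + 3 * (r / 2) \<le> R"
      using u(3) \<open>mdist X y u < r\<close> Suc.prems(3) by linarith
    then show ?thesis
      using Suc.prems(2,5) by (intro Suc.IH[OF c, of "r / 2"]) auto
  qed simp
  have S_eq: "S = (\<Union>c\<in>C. S \<inter> mball_of X c (r / 2))"
    using C(4) Suc.prems(4) by blast
  have "finite (\<Union>c\<in>C. S \<inter> mball_of X c (r / 2))"
    using C(2) piece by (intro finite_UN_I) blast+
  then have "finite S"
    by (simp only: S_eq[symmetric])
  have "card S \<le> (\<Sum>c\<in>C. card (S \<inter> mball_of X c (r / 2)))"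
    by (subst S_eq) (rule card_UN_le[OF C(2)])
  also have "\<dots> \<le> card C * N ^ k"
    using sum_bounded_above[of C "\<lambda>c. card (S \<inter> mball_of X c (r / 2))" "N ^ k"] piece by simp
  also have "\<dots> \<le> N ^ Suc k"
    using C(3) by simp
  finally show ?case
    using \<open>finite S\<close> by simp
qed

lemma mspace_blow_up [simp]: "0 < l \<Longrightarrow> mspace (blow_up X l) = mspace X"
  and mdist_blow_up [simp]: "0 < l \<Longrightarrow> mdist (blow_up X l) u v = mdist X u v / l"
proof -
  assume l: "0 < l"
  interpret Metric_space "mspace X" "\<lambda>a b. (1 / l) * mdist X a b"
  proof
    show "(1 / l) * mdist X a c \<le> (1 / l) * mdist X a b + (1 / l) * mdist X b c"
      if "a \<in> mspace X" "b \<in> mspace X" "c \<in> mspace X" for a b c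
      using mdist_triangle[OF that] l by (simp add: divide_right_mono flip: add_divide_distrib)
  qed (use l in \<open>auto simp: mdist_commute\<close>)
  show "mspace (blow_up X l) = mspace X" "mdist (blow_up X l) u v = mdist X u v / l"
    using mspace_metric mdist_metric by (simp_all add: blow_up_def)
qed

section \<open>Finite nets in balls of the cone\<close>

locale doubling_busemann_concave_at = busemann_concave_at +
  assumes doubling: "locally_doubling X"
begin

text \<open>
  At small scales the exponential map carries separated subsets of the cone to separated subsets
  of \<open>X\<close>, whose size is bounded by doubling.
\<close>

lemma precone_ball_net:
  assumes "0 < r" "0 < e"
  shows "\<exists>C. finite C \<and> Apex \<in> C \<and> C \<subseteq> precone_points X x \<and> (\<forall>c\<in>C. cone_radius c < r) \<and>
    (\<forall>p\<in>precone_points X x. cone_radius p < r \<longrightarrow> (\<exists>c\<in>C. precone_dist X x p c < e))"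
proof -
  interpret P: Metric_space "precone_points X x" "precone_dist X x"
    by (rule Metric_space_precone)
  obtain R N where "0 < R" and N: "\<And>y r. y \<in> mball_of X x R \<Longrightarrow> 0 < r \<Longrightarrow> r \<le> R \<Longrightarrow>
      \<exists>C. C \<subseteq> mspace X \<and> finite C \<and> card C \<le> N \<and> mball_of X y r \<subseteq> (\<Union>c\<in>C. mball_of X c (r / 2))"
    using doubling base unfolding locally_doubling_def by metis
  \<comment> \<open>At scale \<open>l\<close> an \<open>e\<close>-separated set in the cone will be
    \<open>e / 2 * l\<close>-separated in \<open>X\<close>; \<open>k\<close> is chosen to match
    this.\<close>
  obtain k where "4 * r / e < 2 ^ k"
    using real_arch_pow[of 2 "4 * r / e"] by auto
  then have k: "2 * r / 2 ^ k \<le> e / 2"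
    using \<open>0 < e\<close> by (simp add: field_simps)
  \<comment> \<open>Requiring \<open>Apex\<close> ensures that the net contains it; it serves later
    as base point of the gluing.\<close>
  define Sep where "Sep C \<longleftrightarrow> finite C \<and> Apex \<in> C \<and> C \<subseteq> precone_points X x \<and> (\<forall>c\<in>C. cone_radius c < r) \<and>
    (\<forall>p\<in>C. \<forall>q\<in>C. p \<noteq> q \<longrightarrow> e \<le> precone_dist X x p q)" for C
  have bound: "card C \<le> N ^ k" if "Sep C" for C
  proof -
    have C: "finite C" "C \<subseteq> precone_points X x" "\<And>c. c \<in> C \<Longrightarrow> cone_radius c < r"
      "\<And>p q. p \<in> C \<Longrightarrow> q \<in> C \<Longrightarrow> p \<noteq> q \<Longrightarrow> e \<le> precone_dist X x p q"
      using that by (auto simp: Sep_def)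
    \<comment> \<open>Provides the margin \<open>3 * (l * r) \<le> R\<close> demanded by
      \<open>card_separated_le\<close>.\<close>
    have "\<forall>\<^sub>F l in at_right 0. l < R / (3 * r)"
      using \<open>0 < R\<close> \<open>0 < r\<close> by (auto simp: eventually_at_right_field intro!: exI[of _ "R / (3 * r)"])
    moreover have "\<forall>\<^sub>F l in at_right 0. \<forall>p\<in>C. l \<in> cone_dom x p"
      using C by (intro eventually_ball_finite ballI eventually_in_cone_dom) auto
    \<comment> \<open>For distinct points the quotient tends to a distance of at least
      \<open>e\<close>, and finitely many pairs share one scale.\<close>
    moreover have "\<forall>\<^sub>F l in at_right 0. \<forall>p\<in>C. \<forall>q\<in>C. p \<noteq> q \<longrightarrow> e / 2 < quot p q l"
    proof (intro eventually_ball_finite ballI C(1))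
      fix p q assume "p \<in> C" "q \<in> C"
      show "\<forall>\<^sub>F l in at_right 0. p \<noteq> q \<longrightarrow> e / 2 < quot p q l"
      proof (cases "p = q")
        case False
        then have "e / 2 < precone_dist X x p q"
          using C(4)[OF \<open>p \<in> C\<close> \<open>q \<in> C\<close>] \<open>0 < e\<close> by linarith
        then have "\<forall>\<^sub>F l in at_right 0. e / 2 < quot p q l"
          using C(2) \<open>p \<in> C\<close> \<open>q \<in> C\<close> by (intro order_tendstoD(1)[OF tendsto_quot]) auto
        then show ?thesis
          by eventually_elim simp
      qed simp
    qed
    ultimately have "\<forall>\<^sub>F l in at_right 0. 0 < l \<and> l < R / (3 * r) \<and> (\<forall>p\<in>C. l \<in> cone_dom x p) \<and>
        (\<forall>p\<in>C. \<forall>q\<in>C. p \<noteq> q \<longrightarrow> e / 2 < quot p q l)"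
      using eventually_at_right_less[of "0::real"] by eventually_elim simp
    then obtain l where l: "0 < l" "l < R / (3 * r)" "\<And>p. p \<in> C \<Longrightarrow> l \<in> cone_dom x p"
        "\<And>p q. p \<in> C \<Longrightarrow> q \<in> C \<Longrightarrow> p \<noteq> q \<Longrightarrow> e / 2 < quot p q l"
      using eventually_happens'[OF trivial_limit_at_right_real] by blast
    have far: "e / 2 * l \<le> mdist X (cone_exp x p l) (cone_exp x q l)" if "p \<in> C" "q \<in> C" "p \<noteq> q" for p q
      using l(4)[OF that] l(1) by (simp add: quot_def field_simps)
    have "inj_on (\<lambda>p. cone_exp x p l) C"
    proof (rule inj_onI, rule ccontr)
      fix p q assume pq: "p \<in> C" "q \<in> C" "cone_exp x p l = cone_exp x q l" "p \<noteq> q"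
      then have "mdist X (cone_exp x p l) (cone_exp x q l) = 0"
        using cone_exp_in[of q l] C(2) l(3) by auto
      moreover have "0 < e / 2 * l"
        using \<open>0 < e\<close> l(1) by simp
      ultimately show False
        using far[OF pq(1,2,4)] by linarith
    qed
    then have "card C = card ((\<lambda>p. cone_exp x p l) ` C)"
      by (simp add: card_image)
    also have "\<dots> \<le> N ^ k"
    proof (rule conjunct2[OF card_separated_le[where r = "l * r", OF N base base]])
      show "0 < l * r"
        using l(1) \<open>0 < r\<close> by simp
      show "mdist X x x + 3 * (l * r) \<le> R"
        using l(2) \<open>0 < r\<close> mdist_refl[OF base] by (simp add: field_simps)
      show "(\<lambda>p. cone_exp x p l) ` C \<subseteq> mball_of X x (l * r)"
        using C(2,3) l(1,3) base by (auto simp: cone_exp_in mdist_cone_exp subset_iff)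
      fix u v assume "u \<in> (\<lambda>p. cone_exp x p l) ` C" "v \<in> (\<lambda>p. cone_exp x p l) ` C" "u \<noteq> v"
      then have "e / 2 * l \<le> mdist X u v"
        using far by blast
      moreover have "2 * (l * r) / 2 ^ k \<le> e / 2 * l"
        using mult_right_mono[OF k, of l] l(1) by (simp add: mult.commute mult.left_commute)
      ultimately show "2 * (l * r) / 2 ^ k \<le> mdist X u v"
        by linarith
    qed
    finally show ?thesis .
  qed
  have "Sep {Apex}"
    using \<open>0 < r\<close> by (simp add: Sep_def)
  \<comment> \<open>The bound yields a largest separated set, which is a net: a point far from all
    its members could be added.\<close>
  then have "\<exists>C. Sep C \<and> (\<forall>C'. Sep C' \<longrightarrow> card C' \<le> card C)"
    by (rule ex_has_greatest_nat[where b = "Suc (N ^ k)"]) (simp add: bound less_Suc_eq_le)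
  then obtain C where C: "Sep C" and max: "\<And>C'. Sep C' \<Longrightarrow> card C' \<le> card C"
    by blast
  have "\<exists>c\<in>C. precone_dist X x p c < e" if p: "p \<in> precone_points X x" "cone_radius p < r" for p
  proof (rule ccontr)
    assume "\<not> (\<exists>c\<in>C. precone_dist X x p c < e)"
    then have far: "e \<le> precone_dist X x p c" if "c \<in> C" for c
      using that by force
    then have "Sep (insert p C)"
      using C p P.commute unfolding Sep_def by auto
    moreover have "p \<notin> C"
      using far[of p] p(1) \<open>0 < e\<close> by auto
    ultimately show False
      using max[of "insert p C"] C by (simp add: Sep_def)
  qed
  then show ?thesis
    using C unfolding Sep_def by blast
qed

section \<open>The completed cone and compactness of its balls\<close>

definition cone_incl :: "'a cone_point \<Rightarrow> 'a cone_point \<Rightarrow> real" where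
  "cone_incl = snd (metric_completion_of (precone X x))"

lemma tangent_apex_eq: "tangent_apex X x = cone_incl Apex"
  by (simp add: tangent_apex_def cone_incl_def)

lemma completion: "is_metric_completion (precone X x) (tangent_cone X x) cone_incl"
  unfolding tangent_cone_def cone_incl_def by (rule is_metric_completion_metric_completion_of)

lemma mcomplete_tangent_cone: "mcomplete_of (tangent_cone X x)"
  using completion by (simp add: is_metric_completion_def)

lemma cone_incl_in: "p \<in> precone_points X x \<Longrightarrow> cone_incl p \<in> mspace (tangent_cone X x)"
  and mdist_cone_incl: "p \<in> precone_points X x \<Longrightarrow> q \<in> precone_points X x \<Longrightarrow>
    mdist (tangent_cone X x) (cone_incl p) (cone_incl q) = precone_dist X x p q"
  using completion isometric_embeddingD[of "precone X x" "tangent_cone X x" cone_incl]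
  by (auto simp: is_metric_completion_def)

lemma mdist_tangent_apex:
  "p \<in> precone_points X x \<Longrightarrow> mdist (tangent_cone X x) (tangent_apex X x) (cone_incl p) = cone_radius p"
  by (simp add: tangent_apex_eq mdist_cone_incl precone_dist_Apex)

lemma tangent_apex_in: "tangent_apex X x \<in> mspace (tangent_cone X x)"
  by (simp add: tangent_apex_eq cone_incl_in)

text \<open>Density of the precone carries its nets over to the completion. The net stays in the
  precone, where the exponential map is defined.\<close>

lemma tangent_cone_ball_net:
  assumes "0 < r" "0 < e"
  shows "\<exists>C. finite C \<and> Apex \<in> C \<and> C \<subseteq> precone_points X x \<and> (\<forall>c\<in>C. cone_radius c < r) \<and>
    (\<forall>v\<in>mball_of (tangent_cone X x) (tangent_apex X x) r. \<exists>c\<in>C. mdist (tangent_cone X x) v (cone_incl c) < e)"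
proof -
  let ?T = "tangent_cone X x" and ?o = "tangent_apex X x"
  interpret T: Metric_space "mspace ?T" "mdist ?T" by simp
  obtain C where C: "finite C" "Apex \<in> C" "C \<subseteq> precone_points X x" "\<forall>c\<in>C. cone_radius c < r"
    and net: "\<And>p. p \<in> precone_points X x \<Longrightarrow> cone_radius p < r \<Longrightarrow> \<exists>c\<in>C. precone_dist X x p c < e / 2"
    using precone_ball_net[OF assms(1) half_gt_zero[OF assms(2)]] by blast
  have "\<exists>c\<in>C. mdist ?T v (cone_incl c) < e" if v: "v \<in> mball_of ?T ?o r" for v
  proof -
    \<comment> \<open>The first bound leaves \<open>e / 2\<close> for the net; the second keeps the
      approximating \<open>p\<close> inside the open ball.\<close>
    define \<delta> where "\<delta> = min (e / 2) (r - mdist ?T ?o v)"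
    have "0 < \<delta>" and vT: "v \<in> mspace ?T"
      using v \<open>0 < e\<close> by (auto simp: \<delta>_def)
    have "v \<in> T.mtopology closure_of (cone_incl ` precone_points X x)"
      using completion vT by (simp add: is_metric_completion_def mtopology_of_def)
    then obtain p where p: "p \<in> precone_points X x" "mdist ?T v (cone_incl p) < \<delta>"
      using \<open>0 < \<delta>\<close> unfolding T.metric_closure_of by auto
    have "mdist ?T ?o (cone_incl p) \<le> mdist ?T ?o v + mdist ?T v (cone_incl p)"
      by (intro mdist_triangle tangent_apex_in vT cone_incl_in p)
    then have "cone_radius p < r"
      using p by (simp add: mdist_tangent_apex \<delta>_def)
    then obtain c where c: "c \<in> C" "precone_dist X x p c < e / 2"
      using net[OF p(1)] by blast
    have "mdist ?T v (cone_incl c) \<le> mdist ?T v (cone_incl p) + mdist ?T (cone_incl p) (cone_incl c)"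
      using c(1) C(3) by (intro mdist_triangle vT cone_incl_in p) auto
    also have "\<dots> < e"
      using p c C(3) by (auto simp: mdist_cone_incl \<delta>_def subset_iff)
    finally show ?thesis
      using c(1) by blast
  qed
  then show ?thesis
    using C by blast
qed

lemma compactin_tangent_cone_mcball:
  "compactin (mtopology_of (tangent_cone X x)) (mcball_of (tangent_cone X x) (tangent_apex X x) R)"
proof (rule compactin_mcball_of[OF mcomplete_tangent_cone])
  let ?T = "tangent_cone X x" and ?o = "tangent_apex X x"
  interpret T: Metric_space "mspace ?T" "mdist ?T" by simp
  \<comment> \<open>This open ball contains the closed one, and its radius is positive for negative
    \<open>R\<close> too.\<close>
  have "T.mtotally_bounded (T.mball ?o (\<bar>R\<bar> + 1))"
    unfolding T.mtotally_bounded_def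
  proof (intro strip)
    fix e :: real assume "0 < e"
    have "0 < \<bar>R\<bar> + 1" by simp
    from tangent_cone_ball_net[OF this \<open>0 < e\<close>] obtain C where C: "finite C" "C \<subseteq> precone_points X x" "\<forall>c\<in>C. cone_radius c < \<bar>R\<bar> + 1"
      and net: "\<And>v. v \<in> T.mball ?o (\<bar>R\<bar> + 1) \<Longrightarrow> \<exists>c\<in>C. mdist ?T v (cone_incl c) < e"
      unfolding mball_of_def by blast
    have "T.mball ?o (\<bar>R\<bar> + 1) \<subseteq> (\<Union>v\<in>cone_incl ` C. T.mball v e)"
    proof
      fix v assume v: "v \<in> T.mball ?o (\<bar>R\<bar> + 1)"
      then obtain c where "c \<in> C" "mdist ?T v (cone_incl c) < e"
        using net by blast
      then show "v \<in> (\<Union>v\<in>cone_incl ` C. T.mball v e)"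
        using v C(2) by (auto simp: T.in_mball mdist_commute cone_incl_in subset_iff)
    qed
    moreover have "cone_incl ` C \<subseteq> T.mball ?o (\<bar>R\<bar> + 1)"
      using C(2,3) by (auto simp: T.in_mball tangent_apex_in cone_incl_in mdist_tangent_apex subset_iff)
    ultimately show "\<exists>K. finite K \<and> K \<subseteq> T.mball ?o (\<bar>R\<bar> + 1) \<and> T.mball ?o (\<bar>R\<bar> + 1) \<subseteq> (\<Union>v\<in>K. T.mball v e)"
      using C(1) by blast
  qed
  then show "T.mtotally_bounded (mcball_of ?T ?o R)"
    by (rule T.mtotally_bounded_subset) (auto simp: mcball_of_def T.in_mball T.in_mcball)
qed

lemma locally_compact_tangent_cone: "locally_compact_space (mtopology_of (tangent_cone X x))"
  unfolding locally_compact_space_def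
proof
  let ?T = "tangent_cone X x" and ?o = "tangent_apex X x"
  interpret T: Metric_space "mspace ?T" "mdist ?T" by simp
  fix v assume "v \<in> topspace (mtopology_of ?T)"
  then have v: "v \<in> mball_of ?T ?o (mdist ?T ?o v + 1)"
    using tangent_apex_in by simp
  moreover have "openin (mtopology_of ?T) (mball_of ?T ?o (mdist ?T ?o v + 1))"
    by (simp add: mtopology_of_def mball_of_def)
  moreover have "mball_of ?T ?o (mdist ?T ?o v + 1) \<subseteq> mcball_of ?T ?o (mdist ?T ?o v + 1)"
    by auto
  ultimately show "\<exists>U K. openin (mtopology_of ?T) U \<and> compactin (mtopology_of ?T) K \<and> v \<in> U \<and> U \<subseteq> K"
    using compactin_tangent_cone_mcball by blast
qed

section \<open>Convergence of the blow-ups\<close>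

text \<open>Each point \<open>c\<close> of a finite net is matched with
  \<open>cone_exp x c l\<close>. For small \<open>l\<close> the distances nearly agree, and the two
  balls are glued along these pairs.\<close>

lemma eventually_pointed_GH_dist_le:
  assumes "0 < r" "0 < e"
  shows "\<forall>\<^sub>F l in at_right 0. pointed_GH_dist (pointed_ball (blow_up X l) x r) x
           (pointed_ball (tangent_cone X x) (tangent_apex X x) r) (tangent_apex X x) \<le> ennreal e"
proof -
  let ?T = "tangent_cone X x" and ?o = "tangent_apex X x"
  obtain C where C: "finite C" "Apex \<in> C" "C \<subseteq> precone_points X x" "\<forall>c\<in>C. cone_radius c < r"
    and net: "\<And>v. v \<in> mball_of ?T ?o r \<Longrightarrow> \<exists>c\<in>C. mdist ?T v (cone_incl c) < e / 2"
    using tangent_cone_ball_net[OF assms(1) half_gt_zero[OF assms(2)]] by blast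
  have CP: "c \<in> precone_points X x" if "c \<in> C" for c
    using C(3) that by blast
  \<comment> \<open>Length 0 at the apex identifies the base points; the other segments have length
    \<open>e / 2\<close>, so any two distinct net points allow a distortion of
    \<open>e / 2\<close>.\<close>
  define w where "w c = (if c = Apex then 0 else e / 2)" for c :: "'a cone_point"
  have "\<forall>\<^sub>F l in at_right 0. \<forall>c\<in>C. l \<in> cone_dom x c"
    using C by (intro eventually_ball_finite ballI eventually_in_cone_dom) auto
  moreover have "\<forall>\<^sub>F l in at_right 0. \<forall>c\<in>C. \<forall>c'\<in>C. dist (quot c c' l) (precone_dist X x c c') < e / 2"
    using \<open>0 < e\<close> by (intro eventually_ball_finite ballI C(1) tendstoD[OF tendsto_quot] CP) auto
  ultimately show ?thesis
    using eventually_at_right_less[of "0::real"]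
  proof eventually_elim
    case (elim l)
    let ?A = "pointed_ball (blow_up X l) x r" and ?B = "pointed_ball ?T ?o r"
    have quot: "mdist ?A (cone_exp x p l) (cone_exp x q l) = quot p q l" for p q
      using elim(3) by (simp add: pointed_ball_def quot_def)
    have "pointed_GH_dist ?A (cone_exp x Apex l) ?B (cone_incl Apex) \<le> ennreal e"
    proof (rule pointed_GH_dist_le_gluing[where C = C and w = w and \<alpha> = "\<lambda>c. cone_exp x c l" and \<beta> = cone_incl])
      show "finite C" "Apex \<in> C" "w Apex = 0" "\<And>c. c \<in> C \<Longrightarrow> c \<noteq> Apex \<Longrightarrow> 0 < w c"
        using C \<open>0 < e\<close> by (auto simp: w_def)
      fix c assume c: "c \<in> C"
      have "l \<in> cone_dom x c" "cone_radius c < r"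
        using c elim(1) C(4) by auto
      then show "cone_exp x c l \<in> mspace ?A"
        using elim(3) base cone_exp_in[OF CP[OF c]] mdist_cone_exp[OF CP[OF c]] by (simp add: pointed_ball_def)
      show "cone_incl c \<in> mspace ?B"
        using \<open>cone_radius c < r\<close> CP[OF c] by (simp add: pointed_ball_def tangent_apex_in cone_incl_in mdist_tangent_apex)
      fix c' assume c': "c' \<in> C"
      show "\<bar>mdist ?A (cone_exp x c l) (cone_exp x c' l) - mdist ?B (cone_incl c) (cone_incl c')\<bar> \<le> w c + w c'"
      proof (cases "c = c'")
        \<comment> \<open>At the apex the allowance is 0, so equal points need an exact
          computation.\<close>
        case True
        then have "quot c c' l = 0" "mdist ?T (cone_incl c) (cone_incl c') = 0"
          using cone_exp_in[OF CP[OF c]] \<open>l \<in> cone_dom x c\<close> cone_incl_in[OF CP[OF c]] by (simp_all add: quot_def)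
        then show ?thesis
          using \<open>0 < e\<close> unfolding quot by (simp add: pointed_ball_def w_def)
      next
        case False
        then have "e / 2 \<le> w c + w c'"
          using \<open>0 < e\<close> by (auto simp: w_def)
        moreover have "dist (quot c c' l) (precone_dist X x c c') < e / 2"
          using elim(2) c c' by blast
        moreover have "mdist ?B (cone_incl c) (cone_incl c') = precone_dist X x c c'"
          using mdist_cone_incl[OF CP[OF c] CP[OF c']] by (simp add: pointed_ball_def)
        ultimately show ?thesis
          unfolding quot dist_real_def by linarith
      qed
    next
      have w: "w c \<le> e / 2" for c
        using \<open>0 < e\<close> by (simp add: w_def)
      show "\<exists>c\<in>C. mdist ?B v (cone_incl c) + w c < e" if "v \<in> mspace ?B" for v
      proof -
        obtain c where "c \<in> C" "mdist ?T v (cone_incl c) < e / 2"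
          using net[of v] \<open>v \<in> mspace ?B\<close> by (auto simp: pointed_ball_def)
        then show ?thesis
          using w[of c] by (intro bexI[of _ c]) (auto simp: pointed_ball_def)
      qed
      \<comment> \<open>Pull \<open>u\<close> back to the cone ball, choose a net point near the
        preimage and push it forward. The exponential map is 1-Lipschitz at every scale in its
        domain, so \<open>l\<close> need not depend on \<open>u\<close>.\<close>
      show "\<exists>c\<in>C. mdist ?A u (cone_exp x c l) + w c < e" if "u \<in> mspace ?A" for u
      proof -
        have u: "u \<in> mspace X" "mdist X x u / l < r"
          using \<open>u \<in> mspace ?A\<close> elim(3) by (auto simp: pointed_ball_def)
        obtain p where p: "p \<in> precone_points X x" "l \<in> cone_dom x p" "cone_exp x p l = u" "cone_radius p < r"
          using cone_exp_surj[OF u(1) elim(3)] u(2) by auto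
        then have "cone_incl p \<in> mball_of ?T ?o r"
          by (simp add: tangent_apex_in cone_incl_in mdist_tangent_apex)
        then obtain c where c: "c \<in> C" "mdist ?T (cone_incl p) (cone_incl c) < e / 2"
          using net by blast
        have "mdist ?A u (cone_exp x c l) = quot p c l"
          using quot p(3) by blast
        also have "\<dots> \<le> precone_dist X x p c"
          using elim(1,3) c(1) by (intro precone_dist_sup(1) p CP) auto
        also have "\<dots> < e / 2"
          using c mdist_cone_incl[OF p(1) CP[OF c(1)]] by simp
        finally show ?thesis
          using w[of c] c(1) by (intro bexI[of _ c]) auto
      qed
    qed
    then show ?case
      by (simp add: cone_exp_def tangent_apex_eq)
  qed
qed

lemma pointed_GH_limit_tangent_cone:
  "pointed_GH_limit (blow_up X) (\<lambda>_. x) (tangent_cone X x) (tangent_apex X x) (at_right 0)"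
  unfolding pointed_GH_limit_def
proof (intro conjI allI impI tangent_apex_in order_tendstoI)
  fix r :: real and a :: ennreal assume "0 < r" "0 < a"
  then obtain b where b: "0 < b" "b < a"
    \<comment> \<open>The estimate above is not strict; an intermediate \<open>b\<close> makes it
      so.\<close>
    using dense by blast
  then obtain e where e: "b = ennreal e" "0 < e"
    by (cases b) auto
  show "\<forall>\<^sub>F l in at_right 0. pointed_GH_dist (pointed_ball (blow_up X l) x r) x
      (pointed_ball (tangent_cone X x) (tangent_apex X x) r) (tangent_apex X x) < a"
    using eventually_pointed_GH_dist_le[OF \<open>0 < r\<close> e(2)] by eventually_elim (use b e in auto)
qed simp

end

text \<open>A space and a dense subspace through the base point are pointed limits of the same
  families, so uniqueness is claimed among complete spaces.\<close>

theorem corollary2p21: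
  fixes X :: "'a metric" and x :: 'a
  assumes "mcomplete_of X" and "proper_metric X" and "geodesic_metric X"
    and "busemann_concave X" and "locally_doubling X"
    and "x \<in> mspace X"
  shows "locally_compact_space (mtopology_of (tangent_cone X x)) \<and>
    pointed_GH_limit (blow_up X) (\<lambda>_. x) (tangent_cone X x) (tangent_apex X x) (at_right 0) \<and>
    (\<forall>(Y :: 'b metric) y.
       mcomplete_of Y \<and> pointed_GH_limit (blow_up X) (\<lambda>_. x) Y y (at_right 0)
       \<longrightarrow> pointed_isometric Y y (tangent_cone X x) (tangent_apex X x))"
proof -
  interpret doubling_busemann_concave_at X x
    using assms by unfold_locales
  \<comment> \<open>\<open>blow_up X l\<close> is known to be the rescaled space only for positive
    \<open>l\<close>.\<close>
  have ev: "\<forall>\<^sub>F l in at_right 0. x \<in> mspace (blow_up X l)"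
    using eventually_at_right_less[of "0::real"] by eventually_elim (simp add: base)
  have "pointed_isometric Y y (tangent_cone X x) (tangent_apex X x)"
    if "mcomplete_of Y" "pointed_GH_limit (blow_up X) (\<lambda>_. x) Y y (at_right 0)" for Y :: "'b metric" and y
    by (rule pointed_GH_limit_unique[OF that(2) pointed_GH_limit_tangent_cone ev trivial_limit_at_right_real that(1)
          compactin_tangent_cone_mcball])
  then show ?thesis
    using locally_compact_tangent_cone pointed_GH_limit_tangent_cone by simp
qed

end
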